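(* Let $q$ be a prime power, let $r$ be a prime integer and let $\mathcal{M}$ be an $\mathbb{F}_q$-subspace of $M_r(\mathbb{F}_q)$. Suppose that the determinantal polynomial of $\mathcal{M}$ is irreducible over $\mathbb{F}_q$ but not absolutely irreducible. Let $A$, $B$ be elements of $\mathcal{M}$ that satisfy $\det A\neq 0$, $\det B=0$. Then $A^{-1}B$ is nilpotent.
   Context: $M_n(K)$ is the $K$-vector space of $n\times n$ matrices over a field $K$. For a $d$-dimensional subspace $\mathcal{M}$ of $M_n(K)$, $d\ge 1$, with basis $M_1,\dots,M_d$, the determinantal polynomial of $\mathcal{M}$ (with respect to this basis) is $P_{\mathcal{M}}(x_1,\dots,x_d)=\det(x_1M_1+\cdots+x_dM_d)\in K[x_1,\dots,x_d]$. A change of basis changes $P_{\mathcal{M}}$ by an invertible linear change of variables, so irreducibility and absolute irreducibility do not depend on the basis. A polynomial over $\mathbb{F}_q$ is irreducible if it is irreducible in $\mathbb{F}_q[x_1,\dots,x_d]$, and absolutely irreducible if it is irreducible over the algebraic closure $\overline{\mathbb{F}}_q$. *)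

theory Defs
  imports
    "HOL-Analysis.Analysis"
    "HOL-Library.Poly_Mapping"
    "HOL-Algebra.Algebraic_Closure_Type"
begin

(* prime and irreducible are to mean the type-class notions, not those of HOL-Algebra. *)

hide_const (open) Divisibility.prime Divisibility.irreducible

(* On vectors of vectors the operators * and ^ act componentwise, and *s of the library is only
   available for vectors over the scalars; hence explicit scaling and powers of matrices. *)

definition matrix_scale :: "'a::times \<Rightarrow> 'a^'n^'m \<Rightarrow> 'a^'n^'m"
  where "matrix_scale c A = (\<chi> i j. c * A $ i $ j)"

interpretation matv: vector_space "matrix_scale :: 'a::field \<Rightarrow> 'a^'n^'m \<Rightarrow> 'a^'n^'m"
  by unfold_locales (simp_all add: matrix_scale_def vec_eq_iff algebra_simps)

definition nilpotent_matrix :: "'a::semiring_1^'n^'n \<Rightarrow> bool"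
  where "nilpotent_matrix A \<longleftrightarrow> (\<exists>k. (((**) A) ^^ k) (mat 1) = 0)"

definition matrix_basis_of :: "('d::finite \<Rightarrow> 'a::field^'n^'n) \<Rightarrow> ('a^'n^'n) set \<Rightarrow> bool"
  where "matrix_basis_of Ms M \<longleftrightarrow>
    inj Ms \<and> matv.independent (range Ms) \<and> matv.span (range Ms) = M"

(* Polynomials in finitely many variables x_k, indexed by the elements k of the type 'd:
   a monomial is its exponent function, and Poly_Mapping provides the convolution product. *)

type_synonym ('d, 'a) mpolynomial = "('d \<Rightarrow>\<^sub>0 nat) \<Rightarrow>\<^sub>0 'a"

definition mpoly_const :: "'a::zero \<Rightarrow> ('d, 'a) mpolynomial"
  where "mpoly_const c = Poly_Mapping.single 0 c"

definition mpoly_var :: "'d \<Rightarrow> ('d, 'a::zero_neq_one) mpolynomial"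
  where "mpoly_var k = Poly_Mapping.single (Poly_Mapping.single k 1) 1"

definition det_polynomial ::
    "('d::finite \<Rightarrow> 'a::field^'n^'n) \<Rightarrow> ('d, 'a) mpolynomial"
  where "det_polynomial Ms =
    det (\<chi> i j. \<Sum>k\<in>UNIV. mpoly_var k * mpoly_const (Ms k $ i $ j))"

definition absolutely_irreducible :: "('d, 'a::field) mpolynomial \<Rightarrow> bool"
  where "absolutely_irreducible p \<longleftrightarrow>
    irreducible (Poly_Mapping.map (to_ac :: 'a \<Rightarrow> 'a alg_closure) p)"

end

(* Over the algebraic closure of F_q let the determinantal polynomial P be a product G H of
   non-units. Some m-th power of the Frobenius map x -> x^q fixes all coefficients of G and H; let
   N(G), N(H) be the products of the first m Frobenius conjugates of G and H. Then
   N(G) and N(H) have coefficients in F_q and N(G) N(H) is a power of P; as P is prime in F_q[x_1, ..., x_d], N(G) is a power of P up to a unit. On the line xA + B,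
   which is defined over F_q, conjugation preserves degrees and orders of vanishing at x = 0, so
   the restrictions g and f of G and P satisfy deg g * ord f = ord g * deg f. Since
   0 < deg g < deg f = r and r is prime, r divides ord f > 0. Hence det (xA + B) = det A * x^r,
   and a Cayley-Hamilton argument shows that A^-1 B is nilpotent. *)

theory Submission
  imports Defs "HOL-Algebra.Sylow"
begin

hide_const (open) up_ring.coeff up_ring.monom Polynomials.degree Polynomials.lead_coeff Coset.order
  Module.smult
unbundle no fps_syntax

subsection \<open>Factorial subrings of integral domains\<close>

text \<open>That N(G) is a unit times a power of P needs P to be prime, not merely irreducible, over
  F_q, hence unique factorization in several variables. It is proved by induction on the number of
  variables. The rings in the first n variables are subsets of one integral domain, the polynomials
  in variables indexed by \<open>nat\<close>; therefore divisibility, irreducibility and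
  factoriality are all taken relative to a subring, and the result is pulled back to variables
  indexed by \<open>'d\<close>. The relation between degrees and orders comes from N(G) = u P^k: on
  the line it gives m deg g = k deg f and m ord g = k ord f with the same m and k. A nonunit factor
  has k > 0, so both factors of P restrict to polynomials of positive degree; this is why 0 < deg g
  < deg f.\<close>

definition is_subring :: "'s::comm_ring_1 set \<Rightarrow> bool"
  where "is_subring S \<longleftrightarrow> 1 \<in> S \<and> (\<forall>a\<in>S. \<forall>b\<in>S. a - b \<in> S \<and> a * b \<in> S)"

definition dvd_in :: "'s::comm_ring_1 set \<Rightarrow> 's \<Rightarrow> 's \<Rightarrow> bool"
  where "dvd_in S a b \<longleftrightarrow> (\<exists>c\<in>S. b = a * c)"

definition irred_in :: "'s::comm_ring_1 set \<Rightarrow> 's \<Rightarrow> bool"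
  where "irred_in S p \<longleftrightarrow> p \<in> S \<and> p \<noteq> 0 \<and> \<not> dvd_in S p 1 \<and>
    (\<forall>a\<in>S. \<forall>b\<in>S. p = a * b \<longrightarrow> dvd_in S a 1 \<or> dvd_in S b 1)"

text \<open>The degree function takes the place of the ascending chain condition.\<close>

definition factorial_in :: "'s::comm_ring_1 set \<Rightarrow> bool"
  where "factorial_in S \<longleftrightarrow> is_subring S \<and>
    (\<exists>\<delta>::'s \<Rightarrow> nat. (\<forall>a\<in>S - {0}. \<forall>b\<in>S - {0}. \<delta> (a * b) = \<delta> a + \<delta> b) \<and>
      (\<forall>a\<in>S - {0}. \<delta> a = 0 \<longrightarrow> dvd_in S a 1)) \<and>
    (\<forall>p a b. irred_in S p \<longrightarrow> a \<in> S \<longrightarrow> b \<in> S \<longrightarrow> dvd_in S p (a * b) \<longrightarrow>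
      dvd_in S p a \<or> dvd_in S p b)"

lemma is_subringD:
  assumes "is_subring S"
  shows "1 \<in> S" "0 \<in> S" "a \<in> S \<Longrightarrow> - a \<in> S" "a \<in> S \<Longrightarrow> b \<in> S \<Longrightarrow> a - b \<in> S"
    "a \<in> S \<Longrightarrow> b \<in> S \<Longrightarrow> a + b \<in> S" "a \<in> S \<Longrightarrow> b \<in> S \<Longrightarrow> a * b \<in> S"
proof -
  have cl: "x - y \<in> S" "x * y \<in> S" if "x \<in> S" "y \<in> S" for x y
    using assms that by (auto simp: is_subring_def)
  show "1 \<in> S" using assms by (simp add: is_subring_def)
  then show z: "0 \<in> S" using cl(1)[of 1 1] by simp
  show neg: "- a \<in> S" if "a \<in> S" for a using cl(1)[OF z that] by simp
  show "a - b \<in> S" "a * b \<in> S" if "a \<in> S" "b \<in> S" using cl that by auto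
  show "a + b \<in> S" if "a \<in> S" "b \<in> S" using cl(1)[OF that(1) neg[OF that(2)]] by simp
qed

lemma factorial_in_degree:
  assumes "factorial_in (S :: 's::comm_ring_1 set)"
  obtains \<delta> :: "'s::comm_ring_1 \<Rightarrow> nat" where
    "\<And>a b. a \<in> S - {0} \<Longrightarrow> b \<in> S - {0} \<Longrightarrow> \<delta> (a * b) = \<delta> a + \<delta> b"
    "\<And>a. a \<in> S - {0} \<Longrightarrow> \<delta> a = 0 \<Longrightarrow> dvd_in S a 1"
proof -
  have "\<exists>\<delta>::'s \<Rightarrow> nat. (\<forall>a\<in>S - {0}. \<forall>b\<in>S - {0}. \<delta> (a * b) = \<delta> a + \<delta> b) \<and>
      (\<forall>a\<in>S - {0}. \<delta> a = 0 \<longrightarrow> dvd_in S a 1)"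
    using assms unfolding factorial_in_def by (elim conjE)
  then obtain \<delta> :: "'s \<Rightarrow> nat" where
    "(\<forall>a\<in>S - {0}. \<forall>b\<in>S - {0}. \<delta> (a * b) = \<delta> a + \<delta> b) \<and>
      (\<forall>a\<in>S - {0}. \<delta> a = 0 \<longrightarrow> dvd_in S a 1)" ..
  then show thesis by (intro that[of \<delta>]) auto
qed

lemma is_subring_sum: "is_subring S \<Longrightarrow> (\<And>i. i \<in> I \<Longrightarrow> f i \<in> S) \<Longrightarrow> sum f I \<in> S"
  by (induction I rule: infinite_finite_induct) (auto intro: is_subringD)

lemma is_subring_power: "is_subring S \<Longrightarrow> a \<in> S \<Longrightarrow> a ^ n \<in> S"
  by (induction n) (auto intro: is_subringD)

lemma dvd_in_mult:
  assumes "is_subring S" "dvd_in S a b" "c \<in> S"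
  shows "dvd_in S a (b * c)"
  using assms unfolding dvd_in_def by (metis is_subringD(6) mult.assoc)

lemma dvd_in_imp_dvd: "dvd_in S a b \<Longrightarrow> a dvd b"
  by (auto simp: dvd_in_def)

text \<open>Descent on \<open>\<delta>\<close>: if \<open>a = x * y\<close> with nonunits,
  positivity of \<open>\<delta> y\<close> makes \<open>\<delta> x\<close> smaller, and an
  irreducible factor of \<open>x\<close> is one of \<open>a\<close>. The inequality in the
  conclusion makes induction over factorizations well-founded.\<close>

lemma irreducible_factor_in:
  fixes S :: "'s::idom set"
  assumes S: "is_subring S"
    and add: "\<And>a b. a \<in> S - {0} \<Longrightarrow> b \<in> S - {0} \<Longrightarrow> \<delta> (a * b) = \<delta> a + (\<delta> b :: nat)"
    and unit: "\<And>a. a \<in> S - {0} \<Longrightarrow> \<delta> a = 0 \<Longrightarrow> dvd_in S a 1"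
    and a: "a \<in> S" "a \<noteq> 0" "\<not> dvd_in S a 1"
  shows "\<exists>p c. irred_in S p \<and> c \<in> S \<and> a = p * c \<and> \<delta> c < \<delta> a"
  using a
proof (induction "\<delta> a" arbitrary: a rule: less_induct)
  case less
  show ?case
  proof (cases "irred_in S a")
    case True
    have "\<delta> 1 = 0" using add[of 1 1] is_subringD(1)[OF S] by simp
    moreover have "\<delta> a > 0" using unit[of a] less.prems by auto
    ultimately show ?thesis using True is_subringD(1)[OF S] by (intro exI[of _ a] exI[of _ 1]) auto
  next
    case False
    then obtain x y where xy: "x \<in> S" "y \<in> S" "a = x * y" "\<not> dvd_in S x 1" "\<not> dvd_in S y 1"
      using less.prems unfolding irred_in_def by blast
    with less.prems have nz: "x \<noteq> 0" "y \<noteq> 0" by auto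
    have da: "\<delta> a = \<delta> x + \<delta> y" using add[of x y] xy nz by auto
    have "\<delta> y > 0" using unit[of y] xy nz by auto
    then obtain p c where pc: "irred_in S p" "c \<in> S" "x = p * c" "\<delta> c < \<delta> x"
      using less.hyps[of x] da xy nz by auto
    have "c \<noteq> 0" using nz pc by auto
    then have "\<delta> (c * y) = \<delta> c + \<delta> y" using add[of c y] pc xy nz by auto
    then show ?thesis using pc da xy is_subringD(6)[OF S pc(2) xy(2)]
      by (intro exI[of _ p] exI[of _ "c * y"]) (auto simp: mult.assoc)
  qed
qed

text \<open>Takes the place of explicit lists of irreducible factors. It serves to distribute a
  constant over a product of polynomials, one irreducible factor at a time.\<close>

lemma factorial_in_induct [consumes 3, case_names unit mult]:
  fixes S :: "'s::idom set"
  assumes S: "factorial_in S" and a: "a \<in> S" "a \<noteq> 0"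
    and unit: "\<And>a. a \<in> S \<Longrightarrow> dvd_in S a 1 \<Longrightarrow> P a"
    and mult: "\<And>p c. irred_in S p \<Longrightarrow> c \<in> S \<Longrightarrow> c \<noteq> 0 \<Longrightarrow> P c \<Longrightarrow> P (p * c)"
  shows "P a"
proof -
  obtain \<delta> :: "'s \<Rightarrow> nat" where
    \<delta>: "\<And>a b. a \<in> S - {0} \<Longrightarrow> b \<in> S - {0} \<Longrightarrow> \<delta> (a * b) = \<delta> a + \<delta> b"
       "\<And>a. a \<in> S - {0} \<Longrightarrow> \<delta> a = 0 \<Longrightarrow> dvd_in S a 1"
    using factorial_in_degree[OF S] by blast
  have sub: "is_subring S" using S by (simp add: factorial_in_def)
  show ?thesis using a
  proof (induction "\<delta> a" arbitrary: a rule: less_induct)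
    case less
    show ?case
    proof (cases "dvd_in S a 1")
      case True then show ?thesis using unit less.prems by auto
    next
      case False
      from irreducible_factor_in[of S \<delta>, OF sub \<delta> less.prems False]
      obtain p c where pc: "irred_in S p" "c \<in> S" "a = p * c" "\<delta> c < \<delta> a" by blast
      with less.prems have "c \<noteq> 0" by auto
      with less.hyps[of c] pc mult show ?thesis by auto
    qed
  qed
qed

subsection \<open>Gauss's lemma\<close>

text \<open>A set rather than a type, because the coefficient ring grows with the number of
  variables while the ambient type stays the same.\<close>

definition polys_over :: "'s::comm_ring_1 set \<Rightarrow> 's poly set"
  where "polys_over S = {p. \<forall>i. coeff p i \<in> S}"

lemma is_subring_polys_over:
  assumes "is_subring S"
  shows "is_subring (polys_over S)"
  unfolding is_subring_def[of "polys_over S"]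
  using is_subringD[OF assms] is_subring_sum[OF assms]
  by (auto simp: polys_over_def coeff_mult intro!: is_subring_sum[OF assms])

lemma const_in_polys_over: "is_subring S \<Longrightarrow> a \<in> S \<Longrightarrow> [:a:] \<in> polys_over S"
  by (auto simp: polys_over_def coeff_pCons is_subringD split: nat.split)

lemma monom_in_polys_over: "is_subring S \<Longrightarrow> a \<in> S \<Longrightarrow> monom a n \<in> polys_over S"
  by (auto simp: polys_over_def is_subringD)

lemma polys_over_coeff: "p \<in> polys_over S \<Longrightarrow> coeff p i \<in> S"
  by (simp add: polys_over_def)

lemma const_dvd_in_iff:
  fixes S :: "'s::idom set"
  assumes S: "is_subring S" and "c \<noteq> 0"
  shows "dvd_in (polys_over S) [:c:] f \<longleftrightarrow> (\<forall>i. dvd_in S c (coeff f i))"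
proof
  assume "dvd_in (polys_over S) [:c:] f"
  then show "\<forall>i. dvd_in S c (coeff f i)"
    by (auto simp: dvd_in_def polys_over_def)
next
  assume *: "\<forall>i. dvd_in S c (coeff f i)"
  \<comment> \<open>The chosen quotient is \<open>0\<close> at \<open>0\<close>, so that
    \<open>map_poly q\<close> acts on every coefficient, including the zeros beyond the
    degree.\<close>
  define q where "q a = (if a = 0 then 0 else SOME b. b \<in> S \<and> a = c * b)" for a
  have q: "q (coeff f i) \<in> S \<and> coeff f i = c * q (coeff f i)" for i
  proof (cases "coeff f i = 0")
    case False
    have "\<exists>b. b \<in> S \<and> coeff f i = c * b" using * by (auto simp: dvd_in_def)
    from someI_ex[OF this] show ?thesis using False by (simp add: q_def)
  qed (auto simp: q_def is_subringD[OF S])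
  have c0: "coeff (map_poly q f) i = q (coeff f i)" for i
    by (rule coeff_map_poly) (simp add: q_def)
  have "map_poly q f \<in> polys_over S" using q by (simp add: polys_over_def c0)
  moreover have "f = [:c:] * map_poly q f"
    by (rule poly_eqI) (use q in \<open>simp add: c0\<close>)
  ultimately show "dvd_in (polys_over S) [:c:] f" unfolding dvd_in_def by blast
qed

text \<open>Gauss's argument: let \<open>i\<close> and \<open>j\<close> be the first positions where
  \<open>c\<close> fails to divide the coefficients of \<open>f\<close> and \<open>g\<close>. In
  coefficient \<open>i + j\<close> of \<open>f * g\<close> all other summands are divisible by
  \<open>c\<close>, so the product of these two coefficients would be as well.\<close>

lemma const_prime_in_polys_over:
  fixes S :: "'s::idom set"
  assumes S: "is_subring S" and "c \<noteq> 0"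
    and prime: "\<And>a b. a \<in> S \<Longrightarrow> b \<in> S \<Longrightarrow> dvd_in S c (a * b) \<Longrightarrow> dvd_in S c a \<or> dvd_in S c b"
    and f: "f \<in> polys_over S" and g: "g \<in> polys_over S"
    and dvd: "dvd_in (polys_over S) [:c:] (f * g)"
  shows "dvd_in (polys_over S) [:c:] f \<or> dvd_in (polys_over S) [:c:] g"
proof (rule ccontr)
  assume "\<not> ?thesis"
  then have "\<exists>i. \<not> dvd_in S c (coeff f i)" "\<exists>i. \<not> dvd_in S c (coeff g i)"
    using const_dvd_in_iff[OF S \<open>c \<noteq> 0\<close>] by auto
  then obtain i j where i: "\<not> dvd_in S c (coeff f i)" "\<And>k. k < i \<Longrightarrow> dvd_in S c (coeff f k)"
    and j: "\<not> dvd_in S c (coeff g j)" "\<And>k. k < j \<Longrightarrow> dvd_in S c (coeff g k)"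
    using exists_least_iff[of "\<lambda>i. \<not> dvd_in S c (coeff f i)"]
      exists_least_iff[of "\<lambda>i. \<not> dvd_in S c (coeff g i)"] by blast
  let ?h = "\<lambda>k. coeff f k * coeff g (i + j - k)"
  have sum_dvd: "dvd_in S c (sum ?h ({..i + j} - {i}))"
  proof -
    have "dvd_in S c (?h k)" if "k \<in> {..i + j} - {i}" for k
    proof (cases "k < i")
      case True then show ?thesis
        using i(2) dvd_in_mult[OF S] polys_over_coeff[OF g] by blast
    next
      case False
      with that have "i + j - k < j" by auto
      then show ?thesis
        using j(2) dvd_in_mult[OF S] polys_over_coeff[OF f] by (metis mult.commute)
    qed
    then have "\<forall>k\<in>{..i + j} - {i}. \<exists>b. b \<in> S \<and> ?h k = c * b" by (auto simp: dvd_in_def)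
    then obtain b where b: "\<And>k. k \<in> {..i + j} - {i} \<Longrightarrow> b k \<in> S \<and> ?h k = c * b k" by metis
    then have "sum ?h ({..i + j} - {i}) = c * sum b ({..i + j} - {i})"
      by (simp add: sum_distrib_left)
    moreover have "sum b ({..i + j} - {i}) \<in> S" using b by (intro is_subring_sum[OF S]) auto
    ultimately show ?thesis unfolding dvd_in_def by blast
  qed
  have "dvd_in S c (coeff (f * g) (i + j))" using dvd const_dvd_in_iff[OF S \<open>c \<noteq> 0\<close>] by auto
  moreover have "coeff (f * g) (i + j) = ?h i + sum ?h ({..i + j} - {i})"
    unfolding coeff_mult by (subst sum.remove[of _ i]) auto
  ultimately obtain x y where "x \<in> S" "y \<in> S" "?h i + c * y = c * x"
    using sum_dvd unfolding dvd_in_def by auto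
  then have "coeff f i * coeff g j = c * (x - y)" "x - y \<in> S"
    using is_subringD(4)[OF S] by (auto simp: algebra_simps)
  then have "dvd_in S c (coeff f i * coeff g j)" unfolding dvd_in_def by blast
  with prime polys_over_coeff[OF f] polys_over_coeff[OF g] i(1) j(1) show False by blast
qed

text \<open>Takes the place of contents and primitive parts: an irreducible factor of
  \<open>c\<close> is prime in \<open>S\<close>, remains prime as a constant polynomial, and so
  divides \<open>h\<close> or \<open>s\<close>, where it is cancelled. A factorization up to a
  constant thus becomes a genuine one over \<open>S\<close>.\<close>

lemma const_mult_split:
  fixes S :: "'s::idom set"
  assumes S: "factorial_in S" and c: "c \<in> S" "c \<noteq> 0"
    and mem: "p \<in> polys_over S" "h \<in> polys_over S" "s \<in> polys_over S"
    and eq: "[:c:] * p = h * s"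
  shows "\<exists>c1 c2 h' s'. c1 \<in> S \<and> c1 \<noteq> 0 \<and> c2 \<in> S \<and> c2 \<noteq> 0 \<and> h' \<in> polys_over S \<and> s' \<in> polys_over S \<and>
    h = [:c1:] * h' \<and> s = [:c2:] * s' \<and> p = h' * s'"
  using S c mem(2,3) eq
proof (induction c arbitrary: h s rule: factorial_in_induct)
  case (unit c)
  have sub: "is_subring S" and subP: "is_subring (polys_over S)"
    using S is_subring_polys_over by (auto simp: factorial_in_def)
  from unit obtain u where u: "u \<in> S" "c * u = 1" by (auto simp: dvd_in_def)
  \<comment> \<open>With \<open>u\<close> inverse to \<open>c\<close>, the whole constant is charged
    to \<open>h\<close>: the witnesses are \<open>c1 = c\<close>, \<open>c2 = 1\<close> and
    \<open>h' = [:u:] * h\<close>.\<close>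
  have cu: "[:c:] * ([:u:] * x) = x" for x using u by (simp add: mult.commute flip: mult.assoc)
  have "p = [:u:] * ([:c:] * p)" using cu by (simp only: mult.left_commute)
  then have "p = ([:u:] * h) * s" using unit by (simp only: mult.assoc)
  moreover have "h = [:c:] * ([:u:] * h)" using cu by simp
  moreover have "[:u:] * h \<in> polys_over S"
    using is_subringD(6)[OF subP] const_in_polys_over[OF sub] u unit by blast
  moreover have "c \<noteq> 0" using u by auto
  ultimately show ?case using unit is_subringD(1)[OF sub]
    by (intro exI[of _ c] exI[of _ 1] exI[of _ "[:u:] * h"] exI[of _ s]) simp
next
  case (mult q c)
  have sub: "is_subring S" and subP: "is_subring (polys_over S)"
    using S is_subring_polys_over by (auto simp: factorial_in_def)
  have q: "q \<in> S" "q \<noteq> 0" using mult by (auto simp: irred_in_def)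
  have eq: "[:q:] * ([:c:] * p) = h * s" using mult by (simp add: mult.commute)
  have "[:c:] * p \<in> polys_over S"
    using is_subringD(6)[OF subP] const_in_polys_over[OF sub] mult mem by blast
  with eq have "dvd_in (polys_over S) [:q:] (h * s)" unfolding dvd_in_def by metis
  then have "dvd_in (polys_over S) [:q:] h \<or> dvd_in (polys_over S) [:q:] s"
    using const_prime_in_polys_over[OF sub q(2) _ \<open>h \<in> _\<close> \<open>s \<in> _\<close>] S mult unfolding factorial_in_def by blast
  then show ?case
  proof
    assume "dvd_in (polys_over S) [:q:] h"
    then obtain h0 where h0: "h0 \<in> polys_over S" "h = [:q:] * h0" by (auto simp: dvd_in_def)
    with eq q have "[:c:] * p = h0 * s" by (simp only: mult.assoc mult_cancel_left) simp
    from mult.IH[OF h0(1) \<open>s \<in> _\<close> this] obtain c1 c2 h' s' where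
      *: "c1 \<in> S" "c1 \<noteq> 0" "c2 \<in> S" "c2 \<noteq> 0" "h' \<in> polys_over S" "s' \<in> polys_over S"
        "h0 = [:c1:] * h'" "s = [:c2:] * s'" "p = h' * s'" by blast
    have "h = [:q * c1:] * h'" using h0 * by (simp add: mult.commute)
    moreover have "q * c1 \<in> S" "q * c1 \<noteq> 0" using * q is_subringD(6)[OF sub] by auto
    ultimately show ?thesis using * by blast
  next
    assume "dvd_in (polys_over S) [:q:] s"
    then obtain s0 where s0: "s0 \<in> polys_over S" "s = [:q:] * s0" by (auto simp: dvd_in_def)
    with eq q have "[:c:] * p = h * s0"
      by (simp only: mult.left_commute[of h] mult_cancel_left) simp
    from mult.IH[OF \<open>h \<in> _\<close> s0(1) this] obtain c1 c2 h' s' where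
      *: "c1 \<in> S" "c1 \<noteq> 0" "c2 \<in> S" "c2 \<noteq> 0" "h' \<in> polys_over S" "s' \<in> polys_over S"
        "h = [:c1:] * h'" "s0 = [:c2:] * s'" "p = h' * s'" by blast
    have "s = [:q * c2:] * s'" using s0 * by (simp add: mult.commute)
    moreover have "q * c2 \<in> S" "q * c2 \<noteq> 0" using * q is_subringD(6)[OF sub] by auto
    ultimately show ?thesis using * by blast
  qed
qed

section \<open>Pseudo-division and irreducible polynomials of positive degree\<close>

lemma pseudo_division_in:
  fixes S :: "'s::idom set"
  assumes S: "is_subring S" and f: "f \<in> polys_over S" and h: "h \<in> polys_over S" "h \<noteq> 0"
  shows "\<exists>k q r. q \<in> polys_over S \<and> r \<in> polys_over S \<and>
    [:lead_coeff h ^ k:] * f = q * h + r \<and> (r = 0 \<or> degree r < degree h)"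
  using f
proof (induction "degree f" arbitrary: f rule: less_induct)
  case less
  note subP = is_subring_polys_over[OF S]
  show ?case
  proof (cases "f = 0 \<or> degree f < degree h")
    case True
    have "[:lead_coeff h ^ 0:] * f = 0 * h + f" by simp
    with True less.prems is_subringD(2)[OF subP] show ?thesis by blast
  next
    case False
    let ?m = "monom (lead_coeff f) (degree f - degree h)"
    let ?c = "lead_coeff h"
    \<comment> \<open>The leading coefficient of \<open>h\<close> need not be invertible, so
      \<open>f\<close> is scaled by it before its top term is cancelled; each round adds one to the
      exponent \<open>k\<close>.\<close>
    define f1 where "f1 = [:?c:] * f - ?m * h"
    have m: "?m \<in> polys_over S" using monom_in_polys_over[OF S] polys_over_coeff less.prems by blast
    have c: "?c \<in> S" using polys_over_coeff[OF h(1)] by blast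
    have f1: "f1 \<in> polys_over S" unfolding f1_def
      using is_subringD(4,6)[OF subP] m const_in_polys_over[OF S c] less.prems h by blast
    \<comment> \<open>Among constants the degree cannot drop strictly, but there \<open>f1\<close>
      vanishes outright.\<close>
    have "f1 = 0 \<or> degree f1 < degree f"
    proof (cases "degree f = 0")
      case True
      with False have "degree h = 0" by auto
      with True have "f1 = 0" unfolding f1_def
        by (auto elim!: degree_eq_zeroE simp: monom_0)
      then show ?thesis ..
    next
      case pos: False
      have fd: "degree (?m * h) \<le> degree f"
        using False degree_mult_le[of ?m h] degree_monom_le[of "lead_coeff f" "degree f - degree h"] by auto
      have "degree f1 \<le> degree f" unfolding f1_def
        by (rule degree_diff_le[OF _ fd]) (simp add: degree_smult_le)
      moreover have "coeff f1 (degree f) = 0" unfolding f1_def using False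
        by (simp add: coeff_monom_mult mult.commute[of "lead_coeff h"])
      ultimately show ?thesis using pos
        by (metis eq_zero_or_degree_less)
    qed
    then have "\<exists>k q r. q \<in> polys_over S \<and> r \<in> polys_over S \<and>
      [:?c ^ k:] * f1 = q * h + r \<and> (r = 0 \<or> degree r < degree h)"
    proof
      assume "f1 = 0"
      then have "[:?c ^ 0:] * f1 = 0 * h + 0" by simp
      with is_subringD(2)[OF subP] show ?thesis by blast
    next
      assume "degree f1 < degree f" then show ?thesis using less.hyps f1 by blast
    qed
    then obtain k q r where kqr: "q \<in> polys_over S" "r \<in> polys_over S"
      "[:?c ^ k:] * f1 = q * h + r" "r = 0 \<or> degree r < degree h" by blast
    have "[:?c ^ Suc k:] * f = [:?c ^ k:] * ([:?c:] * f)" by (simp add: mult.commute)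
    also have "[:?c:] * f = f1 + ?m * h" by (simp add: f1_def)
    also have "[:?c ^ k:] * (f1 + ?m * h) = (q + [:?c ^ k:] * ?m) * h + r"
      using kqr(3) by (simp only: distrib_left distrib_right mult.assoc) (simp add: add_ac)
    finally have "[:?c ^ Suc k:] * f = (q + [:?c ^ k:] * ?m) * h + r" .
    moreover have "q + [:?c ^ k:] * ?m \<in> polys_over S"
      using is_subringD(5,6)[OF subP] m kqr const_in_polys_over[OF S is_subring_power[OF S c]] by blast
    ultimately show ?thesis using kqr by blast
  qed
qed


text \<open>Splitting \<open>c\<close> gives \<open>p = [:c1:] * p'\<close> and
  \<open>f = p' * t'\<close>. Since \<open>p'\<close> has the positive degree of \<open>p\<close>,
  it is not a unit; irreducibility of \<open>p\<close> then makes \<open>[:c1:]\<close> one.\<close>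

lemma const_cancel_irred_in:
  fixes S :: "'s::idom set"
  assumes S: "factorial_in S" and p: "irred_in (polys_over S) p" "degree p > 0"
    and c: "c \<in> S" "c \<noteq> 0" and t: "t \<in> polys_over S" and f: "f \<in> polys_over S"
    and eq: "[:c:] * f = p * t"
  shows "dvd_in (polys_over S) p f"
proof -
  have sub: "is_subring S" and subP: "is_subring (polys_over S)"
    using S is_subring_polys_over by (auto simp: factorial_in_def)
  have pS: "p \<in> polys_over S" using p by (simp add: irred_in_def)
  from const_mult_split[OF S c f pS t eq] obtain c1 p' t' where
    *: "c1 \<in> S" "c1 \<noteq> 0" "p' \<in> polys_over S" "t' \<in> polys_over S" "p = [:c1:] * p'" "f = p' * t'"
    by blast
  have "[:c1:] \<in> polys_over S" using const_in_polys_over[OF sub *(1)] .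
  then have "dvd_in (polys_over S) [:c1:] 1 \<or> dvd_in (polys_over S) p' 1"
    using p(1) * unfolding irred_in_def by blast
  moreover have "\<not> dvd_in (polys_over S) p' 1"
  proof
    assume "dvd_in (polys_over S) p' 1"
    then have "p' dvd 1" by (rule dvd_in_imp_dvd)
    then have "degree p' = 0" using dvd_imp_degree_le[of p' 1] by simp
    with * have "degree p = 0" by simp
    with p show False by simp
  qed
  ultimately obtain u where u: "u \<in> polys_over S" "[:c1:] * u = 1" unfolding dvd_in_def by metis
  have "p * (u * t') = ([:c1:] * u) * (p' * t')" unfolding *(5) by (simp only: mult_ac)
  also have "\<dots> = f" using u * by simp
  finally show ?thesis unfolding dvd_in_def using is_subringD(6)[OF subP u(1) *(4)] by metis
qed

text \<open>Bezout's identity over the fraction field, with constants in place of denominators. A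
  nonzero \<open>h\<close> of least degree in the ideal of \<open>p\<close> and \<open>f\<close>
  divides each member up to a power of its leading coefficient. As \<open>p\<close> does not divide
  \<open>f\<close>, this \<open>h\<close> is a constant \<open>d = u * p + v * f\<close>; multiplied
  by \<open>g\<close> it shows that \<open>p\<close> divides \<open>d * g\<close>, and
  \<open>d\<close> cancels.\<close>

lemma pos_degree_irred_prime_in_polys_over:
  fixes S :: "'s::idom set"
  assumes S: "factorial_in S" and p: "irred_in (polys_over S) p" "degree p > 0"
    and f: "f \<in> polys_over S" and g: "g \<in> polys_over S"
    and dvd: "dvd_in (polys_over S) p (f * g)" and ndvd: "\<not> dvd_in (polys_over S) p f"
  shows "dvd_in (polys_over S) p g"
proof -
  have sub: "is_subring S" and subP: "is_subring (polys_over S)"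
    using S is_subring_polys_over by (auto simp: factorial_in_def)
  have pS: "p \<in> polys_over S" and p0: "p \<noteq> 0" using p by (auto simp: irred_in_def)
  define I where "I = {h. \<exists>u\<in>polys_over S. \<exists>v\<in>polys_over S. h = u * p + v * f}"
  have pI: "p \<in> I" unfolding I_def using is_subringD(1,2)[OF subP]
    by (intro CollectI bexI[of _ 1] bexI[of _ 0]) auto
  have fI: "f \<in> I" unfolding I_def using is_subringD(1,2)[OF subP]
    by (intro CollectI bexI[of _ 0] bexI[of _ 1]) auto
  have Isub: "I \<subseteq> polys_over S" unfolding I_def using is_subringD(5,6)[OF subP] pS f by auto
  have Idiff: "c * x - q * y \<in> I" if "x \<in> I" "y \<in> I" "c \<in> polys_over S" "q \<in> polys_over S" for c x q y
  proof -
    from that obtain u v u' v' where "u \<in> polys_over S" "v \<in> polys_over S" "x = u * p + v * f"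
      "u' \<in> polys_over S" "v' \<in> polys_over S" "y = u' * p + v' * f" by (auto simp: I_def)
    moreover from this have "c * x - q * y = (c * u - q * u') * p + (c * v - q * v') * f"
      by (simp add: algebra_simps)
    moreover from calculation have "c * u - q * u' \<in> polys_over S" "c * v - q * v' \<in> polys_over S"
      using that is_subringD(4,6)[OF subP] by auto
    ultimately show ?thesis unfolding I_def by blast
  qed
  obtain h where h: "h \<in> I" "h \<noteq> 0" "\<And>y. y \<in> I \<Longrightarrow> y \<noteq> 0 \<Longrightarrow> degree h \<le> degree y"
    using ex_has_least_nat[of "\<lambda>h. h \<in> I \<and> h \<noteq> 0" p degree] pI p0 by blast
  have hS: "h \<in> polys_over S" using h Isub by blast
  let ?c = "lead_coeff h"
  have c: "?c \<in> S" using polys_over_coeff[OF hS] .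
  have dvdI: "\<exists>k q. q \<in> polys_over S \<and> [:?c ^ k:] * y = h * q" if y: "y \<in> I" for y
  proof -
    have "y \<in> polys_over S" using y Isub by blast
    from pseudo_division_in[OF sub this hS h(2)] obtain k q r where
      kqr: "q \<in> polys_over S" "[:?c ^ k:] * y = q * h + r" "r = 0 \<or> degree r < degree h" by blast
    have "r = [:?c ^ k:] * y - q * h" using kqr by simp
    then have "r \<in> I"
      using Idiff[OF y h(1) const_in_polys_over[OF sub is_subring_power[OF sub c]] kqr(1)] by simp
    with h(3)[of r] kqr(3) have "r = 0" using not_le by blast
    with kqr show ?thesis by (intro exI[of _ k] exI[of _ q]) (simp add: mult.commute)
  qed
  from dvdI[OF pI] obtain k s where ks: "s \<in> polys_over S" "[:?c ^ k:] * p = h * s" by blast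
  from dvdI[OF fI] obtain l q where lq: "q \<in> polys_over S" "[:?c ^ l:] * f = h * q" by blast
  have ck: "?c ^ k \<in> S" "?c ^ k \<noteq> 0" "?c ^ l \<in> S" "?c ^ l \<noteq> 0"
    using is_subring_power[OF sub c] h(2) by auto
  from const_mult_split[OF S ck(1,2) pS hS ks] obtain c1 h' s' where
    *: "c1 \<in> S" "c1 \<noteq> 0" "h' \<in> polys_over S" "s' \<in> polys_over S" "h = [:c1:] * h'" "p = h' * s'"
    by blast
  \<comment> \<open>Were \<open>s'\<close> a unit, \<open>h'\<close> and hence \<open>h\<close>
    would be a multiple of \<open>p\<close>, so \<open>p\<close> would divide a constant multiple of
    \<open>f\<close> and therefore \<open>f\<close>.\<close>
  have "\<not> dvd_in (polys_over S) s' 1"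
  proof
    assume "dvd_in (polys_over S) s' 1"
    then obtain w where w: "w \<in> polys_over S" "s' * w = 1" unfolding dvd_in_def by metis
    have "p * w = h' * (s' * w)" unfolding *(6) by (simp only: mult.assoc)
    then have "h' = p * w" using w(2) by simp
    then have "[:?c ^ l:] * f = p * ([:c1:] * w * q)" using lq(2) *(5) by (simp only: mult_ac)
    moreover have "[:c1:] * w * q \<in> polys_over S"
      using is_subringD(6)[OF subP] const_in_polys_over[OF sub *(1)] w lq by blast
    ultimately have "dvd_in (polys_over S) p f"
      using const_cancel_irred_in[OF S p ck(3,4) _ f] by blast
    with ndvd show False ..
  qed
  then have "dvd_in (polys_over S) h' 1" using p(1) * unfolding irred_in_def by blast
  then have "h' dvd 1" by (rule dvd_in_imp_dvd)
  then have "degree h' = 0" using dvd_imp_degree_le[of h' 1] by simp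
  then have "degree h = 0" unfolding *(5) by simp
  then obtain d where d: "h = [:d:]" by (rule degree_eq_zeroE)
  have d': "d \<in> S" "d \<noteq> 0" using polys_over_coeff[OF hS, of 0] h(2) d by auto
  obtain t where t: "t \<in> polys_over S" "f * g = p * t" using dvd by (auto simp: dvd_in_def)
  obtain u v where uv: "u \<in> polys_over S" "v \<in> polys_over S" "h = u * p + v * f"
    using h(1) by (auto simp: I_def)
  have "[:d:] * g = u * p * g + v * (f * g)" unfolding d[symmetric] uv(3) by (simp only: distrib_right mult.assoc)
  also have "\<dots> = p * (u * g + v * t)" unfolding t(2) by (simp only: distrib_left mult_ac)
  finally have eq: "[:d:] * g = p * (u * g + v * t)" .
  have "u * g + v * t \<in> polys_over S" using is_subringD(5,6)[OF subP] uv(1,2) t(1) g by blast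
  from const_cancel_irred_in[OF S p d' this g eq] show ?thesis .
qed

theorem factorial_in_polys_over:
  fixes S :: "'s::idom set"
  assumes S: "factorial_in S"
  shows "factorial_in (polys_over S)"
proof -
  have sub: "is_subring S" and subP: "is_subring (polys_over S)"
    using S is_subring_polys_over by (auto simp: factorial_in_def)
  obtain \<delta> :: "'s \<Rightarrow> nat" where
    \<delta>: "\<And>a b. a \<in> S - {0} \<Longrightarrow> b \<in> S - {0} \<Longrightarrow> \<delta> (a * b) = \<delta> a + \<delta> b"
       "\<And>a. a \<in> S - {0} \<Longrightarrow> \<delta> a = 0 \<Longrightarrow> dvd_in S a 1"
    using factorial_in_degree[OF S] by blast
  \<comment> \<open>Additive because leading coefficients multiply; it is zero only for constants
    whose value is a unit of \<open>S\<close>.\<close>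
  define \<epsilon> where "\<epsilon> p = degree p + \<delta> (lead_coeff p)" for p :: "'s poly"
  have add: "\<epsilon> (a * b) = \<epsilon> a + \<epsilon> b"
    if "a \<in> polys_over S - {0}" "b \<in> polys_over S - {0}" for a b
    using that \<delta>(1)[of "lead_coeff a" "lead_coeff b"] polys_over_coeff
    by (auto simp: \<epsilon>_def degree_mult_eq coeff_mult_degree_sum)
  have unit_const: "dvd_in (polys_over S) [:d:] 1" if d: "dvd_in S d 1" for d
  proof -
    from d obtain e where e: "e \<in> S" "d * e = 1" by (auto simp: dvd_in_def)
    then show ?thesis unfolding dvd_in_def using const_in_polys_over[OF sub]
      by (intro bexI[of _ "[:e:]"]) (auto simp: mult.commute)
  qed
  have const_unit: "dvd_in S z 1" if "dvd_in (polys_over S) [:z:] 1" for z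
  proof -
    from that obtain e where e: "e \<in> polys_over S" "1 = [:z:] * e" by (auto simp: dvd_in_def)
    have "1 = z * coeff e 0" using arg_cong[OF e(2), of "\<lambda>q. coeff q 0"] by simp
    then show ?thesis using polys_over_coeff[OF e(1)] by (auto simp: dvd_in_def)
  qed
  have unit: "dvd_in (polys_over S) a 1" if a: "a \<in> polys_over S - {0}" "\<epsilon> a = 0" for a
  proof -
    obtain d where d: "a = [:d:]" using a(2) by (auto simp: \<epsilon>_def elim: degree_eq_zeroE)
    moreover have "d \<in> S - {0}" using a polys_over_coeff[of a S 0] d by auto
    ultimately have "dvd_in S d 1" using \<delta>(2)[of d] a(2) by (simp add: \<epsilon>_def)
    then show ?thesis using unit_const d by simp
  qed
  have prime: "dvd_in (polys_over S) p a \<or> dvd_in (polys_over S) p b"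
    if p: "irred_in (polys_over S) p" and a: "a \<in> polys_over S" and b: "b \<in> polys_over S"
      and ab: "dvd_in (polys_over S) p (a * b)" for p a b
  proof (cases "degree p = 0")
    case False
    then show ?thesis using pos_degree_irred_prime_in_polys_over[OF S p _ a b ab] by blast
  next
    case True
    then obtain d where d: "p = [:d:]" by (rule degree_eq_zeroE)
    have dS: "d \<in> S" "d \<noteq> 0" using p polys_over_coeff[of p S 0] d by (auto simp: irred_in_def)
    have "irred_in S d"
      unfolding irred_in_def
    proof (intro conjI ballI impI)
      show "\<not> dvd_in S d 1" using unit_const p d by (auto simp: irred_in_def)
      fix x y assume xy: "x \<in> S" "y \<in> S" "d = x * y"
      then have "p = [:x:] * [:y:]" using d by simp
      then have "dvd_in (polys_over S) [:x:] 1 \<or> dvd_in (polys_over S) [:y:] 1"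
        using p const_in_polys_over[OF sub] xy unfolding irred_in_def by blast
      then show "dvd_in S x 1 \<or> dvd_in S y 1" using const_unit by blast
    qed (use dS in auto)
    then have "dvd_in S d x \<or> dvd_in S d y" if "x \<in> S" "y \<in> S" "dvd_in S d (x * y)" for x y
      using S that unfolding factorial_in_def by blast
    then show ?thesis using const_prime_in_polys_over[OF sub dS(2) _ a b] ab d by blast
  qed
  show ?thesis
    unfolding factorial_in_def
    by (intro conjI subP exI[of _ \<epsilon>] ballI allI impI add unit prime; assumption)
qed

subsection \<open>Ring homomorphisms\<close>

locale ring_map =
  fixes h :: "'s::comm_ring_1 \<Rightarrow> 't::comm_ring_1"
  assumes map_one: "h 1 = 1"
    and map_add: "h (a + b) = h a + h b"
    and map_mult: "h (a * b) = h a * h b"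
begin

lemma map_zero: "h 0 = 0"
  using map_add[of 0 0] by simp

lemma map_uminus: "h (- a) = - h a"
  using map_add[of a "- a"] by (simp add: map_zero eq_neg_iff_add_eq_0 add.commute)

lemma map_diff: "h (a - b) = h a - h b"
  using map_add[of a "- b"] by (simp add: map_uminus)

lemma map_sum: "h (sum f I) = (\<Sum>i\<in>I. h (f i))"
  by (induction I rule: infinite_finite_induct) (simp_all add: map_zero map_add)

lemma map_prod: "h (prod f I) = (\<Prod>i\<in>I. h (f i))"
  by (induction I rule: infinite_finite_induct) (simp_all add: map_one map_mult)

lemma map_power: "h (a ^ n) = h a ^ n"
  by (induction n) (simp_all add: map_one map_mult)

lemma map_of_int: "h (of_int n) = of_int n"
proof -
  have "h (of_nat m) = of_nat m" for m
    by (induction m) (simp_all add: map_zero map_one map_add)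
  then show ?thesis by (cases n rule: int_cases2) (simp_all add: map_uminus)
qed

lemma map_dvd: "a dvd b \<Longrightarrow> h a dvd h b"
  by (auto simp: map_mult)

lemma is_subring_image: "is_subring S \<Longrightarrow> is_subring (h ` S)"
  unfolding is_subring_def
  by (auto simp flip: map_diff map_mult intro: image_eqI[of 1 h 1] simp: map_one)

lemma injI: "(\<And>a. h a = 0 \<Longrightarrow> a = 0) \<Longrightarrow> inj h"
  by (rule Fun.injI) (metis map_diff right_minus_eq)

end

section \<open>Transport of factoriality along injective homomorphisms\<close>

lemma is_subring_UNIV: "is_subring UNIV"
  by (simp add: is_subring_def)

lemma ring_map_poly: "ring_map (\<lambda>p. poly p t)"
  by unfold_locales simp_all

text \<open>All notions are carried over by the isomorphism of \<open>S\<close> with its image.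
  Injectivity is asked on \<open>S\<close> alone because evaluation at a variable is not injective
  on all polynomials, but is so on those whose coefficients avoid that variable.\<close>

lemma factorial_in_image:
  fixes h :: "'s::idom \<Rightarrow> 't::idom"
  assumes h: "ring_map h" and inj: "inj_on h S" and S: "factorial_in S"
  shows "factorial_in (h ` S)"
proof -
  interpret ring_map h by (rule h)
  have sub: "is_subring S" using S by (simp add: factorial_in_def)
  have dvd_iff: "dvd_in (h ` S) (h a) (h b) \<longleftrightarrow> dvd_in S a b" if "a \<in> S" "b \<in> S" for a b
  proof
    assume "dvd_in (h ` S) (h a) (h b)"
    then obtain c where "c \<in> S" "h b = h (a * c)" by (auto simp: dvd_in_def map_mult)
    then show "dvd_in S a b"
      using inj_onD[OF inj] that is_subringD(6)[OF sub] unfolding dvd_in_def by blast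
  qed (auto simp: dvd_in_def map_mult)
  have unit_iff: "dvd_in (h ` S) (h a) 1 \<longleftrightarrow> dvd_in S a 1" if "a \<in> S" for a
    using dvd_iff[OF that is_subringD(1)[OF sub]] by (simp add: map_one)
  have nz: "h a = 0 \<longleftrightarrow> a = 0" if "a \<in> S" for a
    using inj_onD[OF inj _ that is_subringD(2)[OF sub]] by (auto simp: map_zero)
  obtain \<delta> :: "'s \<Rightarrow> nat" where
    \<delta>: "\<And>a b. a \<in> S - {0} \<Longrightarrow> b \<in> S - {0} \<Longrightarrow> \<delta> (a * b) = \<delta> a + \<delta> b"
       "\<And>a. a \<in> S - {0} \<Longrightarrow> \<delta> a = 0 \<Longrightarrow> dvd_in S a 1"
    using factorial_in_degree[OF S] by blast
  define \<epsilon> where "\<epsilon> = \<delta> \<circ> inv_into S h"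
  have \<epsilon>: "\<epsilon> (h a) = \<delta> a" if "a \<in> S" for a
    using that inj by (simp add: \<epsilon>_def)
  have add: "\<epsilon> (x * y) = \<epsilon> x + \<epsilon> y" if xy: "x \<in> h ` S - {0}" "y \<in> h ` S - {0}" for x y
  proof -
    obtain a b where ab: "a \<in> S" "b \<in> S" "x = h a" "y = h b" using xy by blast
    then have "a \<noteq> 0" "b \<noteq> 0" using xy map_zero by auto
    then show ?thesis using ab \<delta>(1)[of a b] \<epsilon>[of "a * b"] \<epsilon>[of a] \<epsilon>[of b] is_subringD(6)[OF sub]
      by (simp add: map_mult)
  qed
  have unit: "dvd_in (h ` S) x 1" if x: "x \<in> h ` S - {0}" "\<epsilon> x = 0" for x
  proof -
    obtain a where a: "a \<in> S" "x = h a" using x by blast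
    then have "a \<noteq> 0" using x map_zero by auto
    then show ?thesis using a x(2) \<delta>(2)[of a] \<epsilon>[of a] unit_iff[of a] by simp
  qed
  have prime: "dvd_in (h ` S) p a \<or> dvd_in (h ` S) p b"
    if p: "irred_in (h ` S) p" and a: "a \<in> h ` S" and b: "b \<in> h ` S" and ab: "dvd_in (h ` S) p (a * b)"
    for p a b
  proof -
    obtain p' a' b' where *: "p' \<in> S" "a' \<in> S" "b' \<in> S" "p = h p'" "a = h a'" "b = h b'"
      using p a b unfolding irred_in_def by blast
    have "irred_in S p'"
      unfolding irred_in_def
    proof (intro conjI ballI impI)
      show "p' \<noteq> 0" using p * map_zero by (auto simp: irred_in_def)
      show "\<not> dvd_in S p' 1" using p * unit_iff by (auto simp: irred_in_def)
      fix x y assume xy: "x \<in> S" "y \<in> S" "p' = x * y"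
      then have "p = h x * h y" using * by (simp add: map_mult)
      then have "dvd_in (h ` S) (h x) 1 \<or> dvd_in (h ` S) (h y) 1"
        using p xy unfolding irred_in_def by blast
      then show "dvd_in S x 1 \<or> dvd_in S y 1" using unit_iff xy by blast
    qed fact
    moreover have "dvd_in S p' (a' * b')"
      using ab * dvd_iff[of p' "a' * b'"] is_subringD(6)[OF sub] by (simp add: map_mult)
    ultimately have "dvd_in S p' a' \<or> dvd_in S p' b'"
      using S * unfolding factorial_in_def by blast
    then show ?thesis using * dvd_iff by blast
  qed
  show ?thesis
    unfolding factorial_in_def
    by (intro conjI is_subring_image[OF sub] exI[of _ \<epsilon>] ballI allI impI add unit prime; assumption)
qed

text \<open>Base of the induction on the number of variables: a field has no irreducible elements,
  and the zero function serves as degree function.\<close>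

lemma factorial_in_UNIV_field: "factorial_in (UNIV :: 'a::field set)"
proof -
  have unit: "dvd_in UNIV a 1" if "a \<noteq> 0" for a :: 'a
    unfolding dvd_in_def using that by (intro bexI[of _ "inverse a"]) auto
  then have "\<not> irred_in UNIV p" for p :: 'a by (auto simp: irred_in_def)
  moreover have "\<exists>\<delta>::'a \<Rightarrow> nat. (\<forall>a\<in>UNIV - {0}. \<forall>b\<in>UNIV - {0}. \<delta> (a * b) = \<delta> a + \<delta> b) \<and>
      (\<forall>a\<in>UNIV - {0}. \<delta> a = 0 \<longrightarrow> dvd_in UNIV a 1)"
    using unit by (intro exI[of _ "\<lambda>_. 0"]) simp
  ultimately show ?thesis unfolding factorial_in_def using is_subring_UNIV by blast
qed

text \<open>The way back from relative to type-class notions: divisibility inside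
  \<open>range h\<close> mirrors divisibility in \<open>'s\<close>. Only the target has to be an
  integral domain.\<close>

lemma irreducible_imp_prime_elem:
  fixes h :: "'s::comm_ring_1 \<Rightarrow> 't::idom" and p :: 's
  assumes h: "ring_map h" and inj: "inj h" and S: "factorial_in (range h)" and p: "irreducible p"
  shows "prime_elem p"
proof (rule prime_elemI)
  interpret ring_map h by (rule h)
  have dvd_iff: "dvd_in (range h) (h a) (h b) \<longleftrightarrow> a dvd b" for a b
    unfolding dvd_in_def dvd_def using injD[OF inj] by (auto simp flip: map_mult)
  have unit_iff: "dvd_in (range h) (h a) 1 \<longleftrightarrow> a dvd 1" for a
    using dvd_iff[of a 1] by (simp add: map_one)
  have irr: "irred_in (range h) (h p)"
    unfolding irred_in_def
  proof (intro conjI ballI impI)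
    show "h p \<noteq> 0" using p injD[OF inj, of p 0] by (auto simp: map_zero)
    show "\<not> dvd_in (range h) (h p) 1" using irreducible_not_unit[OF p] unit_iff by simp
    fix x y assume "x \<in> range h" "y \<in> range h" "h p = x * y"
    then obtain a b where ab: "x = h a" "y = h b" "h p = h (a * b)" by (auto simp: map_mult)
    then have "p = a * b" using injD[OF inj] by blast
    then show "dvd_in (range h) x 1 \<or> dvd_in (range h) y 1"
      using Factorial_Ring.irreducibleD[OF p] ab unit_iff by blast
  qed simp
  show "p \<noteq> 0" using p by auto
  show "\<not> p dvd 1" using irreducible_not_unit[OF p] .
  fix a b assume "p dvd a * b"
  then have "dvd_in (range h) (h p) (h a * h b)" using dvd_iff by (simp flip: map_mult)
  then have "dvd_in (range h) (h p) (h a) \<or> dvd_in (range h) (h p) (h b)"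
    using S irr unfolding factorial_in_def by blast
  then show "p dvd a \<or> p dvd b" using dvd_iff by blast
qed

subsection \<open>Substitution in polynomials of several variables\<close>

lemma poly_mapping_single_add_induct [case_names single add]:
  assumes single: "\<And>k v. P (Poly_Mapping.single k v)"
    and add: "\<And>f g. P f \<Longrightarrow> P g \<Longrightarrow> P (f + g)"
  shows "P (f :: 'k \<Rightarrow>\<^sub>0 'v::comm_monoid_add)"
proof (induction f rule: Poly_Mapping.update_induct)
  case const
  show ?case using single[of undefined 0] by simp
next
  case (update f a b)
  have "Poly_Mapping.update a b f = f + Poly_Mapping.single a b"
    using update(1)
    by (intro poly_mapping_eqI) (auto simp: lookup_update lookup_add lookup_single in_keys_iff when_def)
  then show ?case using add[OF update(3) single] by simp
qed

lemma single_power_single: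
  "(Poly_Mapping.single (Poly_Mapping.single k 1) 1 :: ('d \<Rightarrow>\<^sub>0 nat) \<Rightarrow>\<^sub>0 'a::comm_semiring_1) ^ n =
    Poly_Mapping.single (Poly_Mapping.single k n) 1"
  by (induction n) (simp_all add: mult_single flip: single_add)

text \<open>Monomials are products of powers of variables. The rule yields that a ring homomorphism
  is determined by its values on constants and variables.\<close>

lemma mpoly_induct [case_names const var add mult]:
  fixes p :: "('d, 'a::comm_semiring_1) mpolynomial"
  assumes const: "\<And>c. P (mpoly_const c)" and var: "\<And>k. P (mpoly_var k)"
    and add: "\<And>p q. P p \<Longrightarrow> P q \<Longrightarrow> P (p + q)"
    and mult: "\<And>p q. P p \<Longrightarrow> P q \<Longrightarrow> P (p * q)"
  shows "P p"
proof (induction p rule: poly_mapping_single_add_induct)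
  case (single e c)
  have "P (Poly_Mapping.single e 1)"
  proof (induction e rule: poly_mapping_single_add_induct)
    case (single k n)
    have "P (mpoly_var k ^ n)"
    proof (induction n)
      case 0
      show ?case using const[of 1] by (simp add: mpoly_const_def)
    qed (simp add: mult var)
    then show ?case by (simp only: mpoly_var_def single_power_single)
  next
    case (add e f)
    then show ?case using mult[of "Poly_Mapping.single e 1" "Poly_Mapping.single f 1"]
      by (simp add: mult_single)
  qed
  from mult[OF const[of c] this] show ?case by (simp add: mpoly_const_def mult_single)
qed (rule add)

text \<open>The coefficient map \<open>c\<close> and the values \<open>v\<close> are kept apart so
  that both renaming of variables and restriction to a line are instances.\<close>

definition mpoly_subst ::
    "('a::comm_ring_1 \<Rightarrow> 's::comm_ring_1) \<Rightarrow> ('d::finite \<Rightarrow> 's) \<Rightarrow> ('d, 'a) mpolynomial \<Rightarrow> 's"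
  where "mpoly_subst c v p =
    (\<Sum>e\<in>Poly_Mapping.keys p. c (Poly_Mapping.lookup p e) * (\<Prod>k\<in>UNIV. v k ^ Poly_Mapping.lookup e k))"

context ring_map
begin

lemma mpoly_subst_single:
  "mpoly_subst h v (Poly_Mapping.single e a) = h a * (\<Prod>k\<in>UNIV. v k ^ Poly_Mapping.lookup e k)"
  by (simp add: mpoly_subst_def map_zero)

lemma mpoly_subst_add: "mpoly_subst h v (p + q) = mpoly_subst h v p + mpoly_subst h v q"
proof -
  \<comment> \<open>The three polynomials have different supports; over the union the sums share one
    index set, the additional terms being zero.\<close>
  let ?K = "Poly_Mapping.keys p \<union> Poly_Mapping.keys q"
  have *: "mpoly_subst h v r =
      (\<Sum>e\<in>?K. h (Poly_Mapping.lookup r e) * (\<Prod>k\<in>UNIV. v k ^ Poly_Mapping.lookup e k))"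
    if "Poly_Mapping.keys r \<subseteq> ?K" for r
    unfolding mpoly_subst_def using that
    by (intro sum.mono_neutral_left) (auto simp: in_keys_iff map_zero)
  show ?thesis
    using *[of p] *[of q] *[of "p + q"] Poly_Mapping.keys_add[of p q]
    by (simp add: lookup_add map_add distrib_right sum.distrib)
qed

lemma ring_map_mpoly_subst: "ring_map (mpoly_subst h v)"
proof
  show "mpoly_subst h v 1 = 1"
    using mpoly_subst_single[of v 0 1] by (simp add: map_one)
  show "mpoly_subst h v (p + q) = mpoly_subst h v p + mpoly_subst h v q" for p q
    by (rule mpoly_subst_add)
  show "mpoly_subst h v (p * q) = mpoly_subst h v p * mpoly_subst h v q" for p q
  proof (induction p rule: poly_mapping_single_add_induct)
    case (single e a)
    show ?case
    proof (induction q rule: poly_mapping_single_add_induct)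
      case (single f b)
      show ?case
        by (simp add: mult_single mpoly_subst_single map_mult lookup_add power_add prod.distrib mult_ac)
    qed (simp add: distrib_left mpoly_subst_add)
  qed (simp add: distrib_right mpoly_subst_add)
qed

lemma mpoly_subst_const: "mpoly_subst h v (mpoly_const a) = h a"
  by (simp add: mpoly_const_def mpoly_subst_single)

lemma mpoly_subst_var: "mpoly_subst h v (mpoly_var k) = v k"
proof -
  have "(\<Prod>j\<in>UNIV. v j ^ Poly_Mapping.lookup (Poly_Mapping.single k 1) j) =
      (\<Prod>j\<in>UNIV. if j = k then v k else 1)"
    by (intro prod.cong) (auto simp: lookup_single when_def)
  then show ?thesis by (simp add: mpoly_var_def mpoly_subst_single map_one)
qed

lemma lookup_map: "Poly_Mapping.lookup (Poly_Mapping.map h p) e = h (Poly_Mapping.lookup p e)"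
  by (simp add: Poly_Mapping.map.rep_eq when_def map_zero)

lemma map_mpoly_const: "Poly_Mapping.map h (mpoly_const a) = mpoly_const (h a)"
  by (simp add: mpoly_const_def map_zero)

lemma map_mpoly_var: "Poly_Mapping.map h (mpoly_var k) = mpoly_var k"
  by (simp add: mpoly_var_def map_one map_zero)

lemma ring_map_mpoly_map:
  "ring_map (Poly_Mapping.map h :: ('d, 's) mpolynomial \<Rightarrow> ('d, 't) mpolynomial)"
proof
  show "Poly_Mapping.map h (1 :: ('d, 's) mpolynomial) = 1"
    using map_mpoly_const[of 1] by (simp add: mpoly_const_def map_one)
  show add: "Poly_Mapping.map h (p + q) = Poly_Mapping.map h p + Poly_Mapping.map h q"
    for p q :: "('d, 's) mpolynomial"
    by (rule poly_mapping_eqI) (simp add: lookup_map lookup_add map_add)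
  show "Poly_Mapping.map h (p * q) = Poly_Mapping.map h p * Poly_Mapping.map h q"
    for p q :: "('d, 's) mpolynomial"
  proof (induction p rule: poly_mapping_single_add_induct)
    case (single e a)
    show ?case
    proof (induction q rule: poly_mapping_single_add_induct)
      case (single f b)
      show ?case by (simp add: mult_single map_mult map_zero)
    qed (simp add: distrib_left add)
  qed (simp add: distrib_right add)
qed

end

lemma ring_map_mpoly_eqI:
  assumes f: "ring_map f" and g: "ring_map g"
    and const: "\<And>c. f (mpoly_const c) = g (mpoly_const c)"
    and var: "\<And>k. f (mpoly_var k) = g (mpoly_var k)"
  shows "f p = g p"
proof -
  interpret f: ring_map f by (rule f)
  interpret g: ring_map g by (rule g)
  show ?thesis
    by (induction p rule: mpoly_induct) (simp_all add: const var f.map_add g.map_add f.map_mult g.map_mult)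
qed

lemma ring_map_comp: "ring_map f \<Longrightarrow> ring_map g \<Longrightarrow> ring_map (\<lambda>x. f (g x))"
  by (simp add: ring_map_def)

subsection \<open>Irreducible polynomials are prime\<close>

lemma lookup_mult_single:
  fixes q :: "'k::cancel_comm_monoid_add \<Rightarrow>\<^sub>0 'v::comm_semiring_1"
  shows "Poly_Mapping.lookup (q * Poly_Mapping.single m c) (e + m) = Poly_Mapping.lookup q e * c"
  by (induction q rule: poly_mapping_single_add_induct)
    (simp_all add: mult_single lookup_single lookup_add distrib_right when_def)

lemma ring_map_single_zero:
  "ring_map (Poly_Mapping.single 0 :: 'a::comm_ring_1 \<Rightarrow> 'k::comm_monoid_add \<Rightarrow>\<^sub>0 'a)"
  by unfold_locales (simp_all add: mult_single flip: single_add)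

text \<open>The polynomials in the variables below \<open>n\<close>, built as a tower inside one
  integral domain so that each level falls under the theorem on \<open>polys_over\<close>.\<close>

fun mpoly_ring :: "nat \<Rightarrow> (nat, 'a::field) mpolynomial set"
  where
    "mpoly_ring 0 = range mpoly_const"
  | "mpoly_ring (Suc n) = (\<lambda>p. poly p (mpoly_var n)) ` polys_over (mpoly_ring n)"

lemma lookup_mpoly_ring:
  assumes "p \<in> mpoly_ring n" "n \<le> j" "Poly_Mapping.lookup p e \<noteq> 0"
  shows "Poly_Mapping.lookup e j = 0"
  using assms
proof (induction n arbitrary: p e)
  case 0
  then show ?case by (auto simp: mpoly_const_def lookup_single when_def split: if_splits)
next
  case (Suc n)
  then obtain f where f: "f \<in> polys_over (mpoly_ring n)" "p = poly f (mpoly_var n)" by auto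
  have "p = (\<Sum>i\<le>degree f. coeff f i * Poly_Mapping.single (Poly_Mapping.single n i) 1)"
    unfolding f(2) poly_altdef mpoly_var_def single_power_single ..
  with Suc.prems(3) have "\<exists>i. Poly_Mapping.lookup (coeff f i * Poly_Mapping.single (Poly_Mapping.single n i) 1) e \<noteq> 0"
    by (auto simp: lookup_sum dest: sum.not_neutral_contains_not_neutral)
  then obtain i where "e \<in> Poly_Mapping.keys (coeff f i * Poly_Mapping.single (Poly_Mapping.single n i) 1)"
    by (auto simp: in_keys_iff)
  with keys_mult[of "coeff f i" "Poly_Mapping.single (Poly_Mapping.single n i) 1"]
  obtain e' where "e' \<in> Poly_Mapping.keys (coeff f i)" "e = e' + Poly_Mapping.single n i" by fastforce
  moreover from this have "Poly_Mapping.lookup e' j = 0"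
    using Suc.IH[OF polys_over_coeff[OF f(1)]] Suc.prems(2) by (auto simp: in_keys_iff)
  ultimately show ?case using Suc.prems(2) by (simp add: lookup_add lookup_single)
qed

text \<open>The coefficients of \<open>f\<close> do not contain the variable \<open>n\<close>, so a
  monomial containing it exactly \<open>i\<close> times comes from the \<open>i\<close>-th term
  alone. This makes evaluation at \<open>mpoly_var n\<close> injective.\<close>

lemma lookup_poly_mpoly_var:
  assumes f: "f \<in> polys_over (mpoly_ring n)" and e: "Poly_Mapping.lookup e n = 0"
  shows "Poly_Mapping.lookup (poly f (mpoly_var n)) (e + Poly_Mapping.single n i) =
    Poly_Mapping.lookup (coeff f i) e"
proof -
  let ?t = "\<lambda>k. coeff f k * Poly_Mapping.single (Poly_Mapping.single n k) 1"
  have "Poly_Mapping.lookup (?t k) (e + Poly_Mapping.single n i) = 0" if "k \<noteq> i" for k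
  proof (rule ccontr)
    assume "\<not> ?thesis"
    then have "e + Poly_Mapping.single n i \<in> Poly_Mapping.keys (?t k)" by (simp add: in_keys_iff)
    with keys_mult[of "coeff f k" "Poly_Mapping.single (Poly_Mapping.single n k) 1"]
    obtain e' where e': "e' \<in> Poly_Mapping.keys (coeff f k)"
      "e + Poly_Mapping.single n i = e' + Poly_Mapping.single n k" by fastforce
    have "Poly_Mapping.lookup e' n = 0"
      using lookup_mpoly_ring[OF polys_over_coeff[OF f] order.refl] e'(1) by (auto simp: in_keys_iff)
    with e arg_cong[OF e'(2), of "\<lambda>e. Poly_Mapping.lookup e n"] that show False
      by (simp add: lookup_add)
  qed
  \<comment> \<open>The index \<open>i\<close> is inserted because it may exceed the degree; its
    term is then zero.\<close>
  then have "(\<Sum>k\<in>insert i {..degree f}. Poly_Mapping.lookup (?t k) (e + Poly_Mapping.single n i)) =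
      Poly_Mapping.lookup (?t i) (e + Poly_Mapping.single n i)"
    by (subst sum.remove[of _ i]) auto
  also have "\<dots> = Poly_Mapping.lookup (coeff f i) e" by (simp add: lookup_mult_single)
  also have "(\<Sum>k\<in>insert i {..degree f}. Poly_Mapping.lookup (?t k) (e + Poly_Mapping.single n i)) =
      (\<Sum>k\<le>degree f. Poly_Mapping.lookup (?t k) (e + Poly_Mapping.single n i))"
    by (rule sum.mono_neutral_right) (auto simp: coeff_eq_0)
  finally show ?thesis unfolding poly_altdef mpoly_var_def single_power_single lookup_sum .
qed

lemma factorial_in_mpoly_ring: "factorial_in (mpoly_ring n :: (nat, 'a::field) mpolynomial set)"
proof (induction n)
  case 0
  have "inj (Poly_Mapping.single 0 :: 'a \<Rightarrow> (nat, 'a) mpolynomial)"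
    by (rule injI) (metis lookup_single_eq)
  from factorial_in_image[OF ring_map_single_zero this factorial_in_UNIV_field]
  show ?case by (simp add: mpoly_const_def[abs_def])
next
  case (Suc n)
  have sub: "is_subring (polys_over (mpoly_ring n :: (nat, 'a) mpolynomial set))"
    using Suc by (intro is_subring_polys_over) (simp add: factorial_in_def)
  have "inj_on (\<lambda>p. poly p (mpoly_var n)) (polys_over (mpoly_ring n :: (nat, 'a) mpolynomial set))"
  proof (rule inj_onI)
    fix f g :: "(nat, 'a) mpolynomial poly"
    assume fg: "f \<in> polys_over (mpoly_ring n)" "g \<in> polys_over (mpoly_ring n)"
      "poly f (mpoly_var n) = poly g (mpoly_var n)"
    define p where "p = f - g"
    have p: "p \<in> polys_over (mpoly_ring n)" "poly p (mpoly_var n) = 0"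
      using fg is_subringD(4)[OF sub] by (auto simp: p_def)
    \<comment> \<open>A monomial \<open>e\<close> with the variable \<open>n\<close> cannot occur in
      a coefficient; for any other \<open>e\<close> the value is read off from
      \<open>poly p (mpoly_var n) = 0\<close>.\<close>
    have "Poly_Mapping.lookup (coeff p i) e = 0" for i e
      using lookup_poly_mpoly_var[OF p(1), of e i] p(2)
        lookup_mpoly_ring[OF polys_over_coeff[OF p(1)] order.refl] by force
    then have "coeff p i = 0" for i by (intro poly_mapping_eqI) simp
    then have "p = 0" by (intro poly_eqI) simp
    then show "f = g" by (simp add: p_def)
  qed
  from factorial_in_image[OF ring_map_poly this factorial_in_polys_over[OF Suc]]
  show ?case by simp
qed

lemma mpoly_ring_subset_Suc: "(mpoly_ring n :: (nat, 'a::field) mpolynomial set) \<subseteq> mpoly_ring (Suc n)"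
proof
  fix p :: "(nat, 'a) mpolynomial"
  assume "p \<in> mpoly_ring n"
  then have "[:p:] \<in> polys_over (mpoly_ring n)"
    using const_in_polys_over factorial_in_mpoly_ring by (auto simp: factorial_in_def)
  then show "p \<in> mpoly_ring (Suc n)" by (auto intro!: image_eqI[of _ _ "[:p:]"])
qed

lemma mpoly_var_in_mpoly_ring: "k < n \<Longrightarrow> mpoly_var k \<in> (mpoly_ring n :: (nat, 'a::field) mpolynomial set)"
proof (induction n)
  case (Suc n)
  show ?case
  proof (cases "k = n")
    case True
    have "1 \<in> (mpoly_ring n :: (nat, 'a) mpolynomial set)" "is_subring (mpoly_ring n :: (nat, 'a) mpolynomial set)"
      using factorial_in_mpoly_ring[of n] is_subringD(1) by (auto simp: factorial_in_def)
    then have "monom 1 1 \<in> polys_over (mpoly_ring n :: (nat, 'a) mpolynomial set)"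
      by (intro monom_in_polys_over)
    then show ?thesis using True by (auto simp: poly_monom intro!: image_eqI[of _ _ "monom 1 1"])
  next
    case False
    then show ?thesis using Suc mpoly_ring_subset_Suc[of n] by auto
  qed
qed simp

text \<open>The type of polynomials is an instance of \<open>idom\<close> only if its variables are linearly ordered;
  hence the variables are numbered.\<close>

definition mpoly_embed :: "('d::finite \<Rightarrow> nat) \<Rightarrow> ('d, 'a::field) mpolynomial \<Rightarrow> (nat, 'a) mpolynomial"
  where "mpoly_embed \<iota> = mpoly_subst mpoly_const (\<lambda>k. mpoly_var (\<iota> k))"

lemma ring_map_mpoly_const: "ring_map (mpoly_const :: 'a::comm_ring_1 \<Rightarrow> ('d, 'a) mpolynomial)"
  unfolding mpoly_const_def[abs_def] by (rule ring_map_single_zero)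

lemma ring_map_mpoly_embed: "ring_map (mpoly_embed \<iota>)"
  unfolding mpoly_embed_def by (rule ring_map.ring_map_mpoly_subst[OF ring_map_mpoly_const])

lemma prod_single_one:
  "(\<Prod>k\<in>I. Poly_Mapping.single (m k) 1) = (Poly_Mapping.single (\<Sum>k\<in>I. m k) 1 :: 'k::comm_monoid_add \<Rightarrow>\<^sub>0 'a::comm_semiring_1)"
  by (induction I rule: infinite_finite_induct) (simp_all add: mult_single)

text \<open>The monomial \<open>e\<close> goes to \<open>\<tau> e\<close>, whose exponent at
  \<open>\<iota> k\<close> is that of \<open>e\<close> at \<open>k\<close>; coefficients are moved
  but never merged.\<close>

lemma inj_mpoly_embed:
  fixes \<iota> :: "'d::finite \<Rightarrow> nat"
  assumes \<iota>: "inj \<iota>"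
  shows "inj (mpoly_embed \<iota> :: ('d, 'a::field) mpolynomial \<Rightarrow> (nat, 'a) mpolynomial)"
proof -
  interpret ring_map "mpoly_embed \<iota> :: ('d, 'a) mpolynomial \<Rightarrow> (nat, 'a) mpolynomial"
    by (rule ring_map_mpoly_embed)
  define \<tau> where "\<tau> e = (\<Sum>k\<in>UNIV. Poly_Mapping.single (\<iota> k) (Poly_Mapping.lookup e k))" for e :: "'d \<Rightarrow>\<^sub>0 nat"
  have "Poly_Mapping.lookup (\<tau> e) (\<iota> k) = Poly_Mapping.lookup e k" for e k
    using injD[OF \<iota>] by (simp add: \<tau>_def lookup_sum lookup_single when_def inj_eq[OF \<iota>])
  then have \<tau>_inj: "\<tau> e = \<tau> f \<longleftrightarrow> e = f" for e f by (metis poly_mapping_eqI)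
  have single: "mpoly_embed \<iota> (Poly_Mapping.single e a) = Poly_Mapping.single (\<tau> e) a" for e and a :: 'a
    unfolding mpoly_embed_def ring_map.mpoly_subst_single[OF ring_map_mpoly_const]
      mpoly_var_def single_power_single prod_single_one
    by (simp add: mpoly_const_def mult_single \<tau>_def)
  have lookup: "Poly_Mapping.lookup (mpoly_embed \<iota> p) (\<tau> e) = Poly_Mapping.lookup p e" for p :: "('d, 'a) mpolynomial" and e
    by (induction p rule: poly_mapping_single_add_induct)
      (simp_all add: single lookup_single \<tau>_inj map_add lookup_add when_def)
  show ?thesis by (rule Fun.injI) (metis lookup poly_mapping_eqI)
qed

text \<open>Identifies the image with a level already known to be factorial. The numbers in use are
  exactly those below \<open>n\<close>, so every step of the tower up to \<open>n\<close> adjoins a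
  variable from the image.\<close>

lemma range_mpoly_embed:
  fixes \<iota> :: "'d::finite \<Rightarrow> nat"
  assumes \<iota>: "range \<iota> = {..<n}"
  shows "range (mpoly_embed \<iota> :: ('d, 'a::field) mpolynomial \<Rightarrow> _) = mpoly_ring n"
proof
  interpret ring_map "mpoly_embed \<iota> :: ('d, 'a) mpolynomial \<Rightarrow> (nat, 'a) mpolynomial"
    by (rule ring_map_mpoly_embed)
  have const: "mpoly_embed \<iota> (mpoly_const c) = mpoly_const c" for c :: 'a
    by (simp add: mpoly_embed_def ring_map.mpoly_subst_const[OF ring_map_mpoly_const])
  have var: "mpoly_embed \<iota> (mpoly_var k) = (mpoly_var (\<iota> k) :: (nat, 'a) mpolynomial)" for k
    by (simp add: mpoly_embed_def ring_map.mpoly_subst_var[OF ring_map_mpoly_const])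
  have sub: "is_subring (mpoly_ring n :: (nat, 'a) mpolynomial set)"
    using factorial_in_mpoly_ring[of n] by (auto simp: factorial_in_def)
  have const_in: "mpoly_const c \<in> mpoly_ring m" for c :: 'a and m
    by (induction m) (use mpoly_ring_subset_Suc in auto)
  have "mpoly_embed \<iota> p \<in> mpoly_ring n" for p :: "('d, 'a) mpolynomial"
  proof (induction p rule: mpoly_induct)
    case (var k)
    have "\<iota> k < n" using \<iota> by auto
    then show ?case by (simp add: \<open>mpoly_embed \<iota> (mpoly_var k) = _\<close> mpoly_var_in_mpoly_ring)
  qed (simp_all add: const const_in map_add map_mult is_subringD[OF sub])
  then show "range (mpoly_embed \<iota> :: ('d, 'a) mpolynomial \<Rightarrow> _) \<subseteq> mpoly_ring n" by auto
  let ?R = "range (mpoly_embed \<iota> :: ('d, 'a) mpolynomial \<Rightarrow> _)"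
  have subR: "is_subring ?R" using is_subring_image[OF is_subring_UNIV] .
  have "mpoly_ring m \<subseteq> ?R" if "m \<le> n" for m
    using that
  proof (induction m)
    case 0
    show ?case using const by (auto intro: rangeI simp flip: const)
  next
    case (Suc m)
    show ?case
    proof
      fix p :: "(nat, 'a) mpolynomial"
      assume "p \<in> mpoly_ring (Suc m)"
      then obtain f where f: "f \<in> polys_over (mpoly_ring m)" "p = poly f (mpoly_var m)" by auto
      have "m \<in> range \<iota>" using \<iota> Suc.prems by auto
      then have "mpoly_var m \<in> ?R" by (auto intro: rangeI simp flip: var)
      then have power: "mpoly_var m ^ i \<in> ?R" for i by (rule is_subring_power[OF subR])
      have "mpoly_ring m \<subseteq> ?R" using Suc by simp
      then have "coeff f i \<in> ?R" for i using polys_over_coeff[OF f(1)] by blast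
      then have "coeff f i * mpoly_var m ^ i \<in> ?R" for i by (rule is_subringD(6)[OF subR _ power])
      then show "p \<in> ?R" unfolding f(2) poly_altdef by (intro is_subring_sum[OF subR])
    qed
  qed
  then show "mpoly_ring n \<subseteq> ?R" by simp
qed

lemma mpoly_embedding_exists:
  obtains h :: "('d::finite, 'a::field) mpolynomial \<Rightarrow> (nat, 'a) mpolynomial"
  where "ring_map h" "inj h" "factorial_in (range h)"
proof -
  obtain \<iota> where \<iota>: "bij_betw \<iota> (UNIV :: 'd set) {0..<CARD('d)}"
    using ex_bij_betw_finite_nat[of "UNIV :: 'd set"] by auto
  then have "inj \<iota>" "range \<iota> = {..<CARD('d)}" by (auto simp: bij_betw_def)
  then show thesis
    using that[of "mpoly_embed \<iota>"] ring_map_mpoly_embed inj_mpoly_embed range_mpoly_embed factorial_in_mpoly_ring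
    by metis
qed

text \<open>The embedding carries irreducibility into its range, so it is this range, a ring in
  finitely many variables, that has to be factorial.\<close>

theorem irreducible_mpoly_prime_elem:
  fixes p :: "('d::finite, 'a::field) mpolynomial"
  assumes "irreducible p"
  shows "prime_elem p"
  using mpoly_embedding_exists irreducible_imp_prime_elem assms by metis

lemma mpoly_mult_left_cancel:
  fixes p :: "('d::finite, 'a::field) mpolynomial"
  assumes "p \<noteq> 0" "p * a = p * b"
  shows "a = b"
proof -
  obtain h :: "('d, 'a) mpolynomial \<Rightarrow> (nat, 'a) mpolynomial" where h: "ring_map h" "inj h"
    using mpoly_embedding_exists by blast
  interpret ring_map h by (rule h(1))
  have "h p \<noteq> 0" using assms(1) injD[OF h(2), of p 0] by (auto simp: map_zero)
  moreover have "h p * h a = h p * h b" using assms(2) by (metis map_mult)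
  ultimately show ?thesis using injD[OF h(2)] by simp
qed

text \<open>Each step strips one \<open>p\<close> from \<open>a\<close> or from \<open>b\<close> and
  cancels it against the power; at exponent \<open>0\<close> what remains of \<open>a\<close> is a
  unit.\<close>

lemma prime_elem_mult_eq_power:
  fixes p :: "('d::finite, 'a::field) mpolynomial"
  assumes p: "prime_elem p" and ab: "a * b = p ^ m"
  shows "\<exists>u k. a = u * p ^ k \<and> u dvd 1"
  using ab
proof (induction m arbitrary: a b)
  case 0
  then have "a dvd 1" by (metis dvd_triv_left power_0)
  then show ?case by (intro exI[of _ a] exI[of _ 0]) simp
next
  case (Suc m)
  then have "p dvd a * b" by simp
  with p have "p dvd a \<or> p dvd b" by (simp add: prime_elem_dvd_mult_iff)
  then show ?case
  proof
    assume "p dvd a"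
    then obtain c where c: "a = p * c" ..
    with Suc.prems have "p * (c * b) = p * p ^ m" by (simp add: mult.assoc)
    then have "c * b = p ^ m" using mpoly_mult_left_cancel p by (metis prime_elem_not_zeroI)
    then obtain u k where "c = u * p ^ k" "u dvd 1" using Suc.IH by blast
    with c have "a = u * p ^ Suc k" "u dvd 1" by (simp_all add: mult.left_commute)
    then show ?thesis by blast
  next
    assume "p dvd b"
    then obtain c where c: "b = p * c" ..
    with Suc.prems have "p * (a * c) = p * p ^ m" by (simp add: mult.left_commute)
    then have "a * c = p ^ m" using mpoly_mult_left_cancel p by (metis prime_elem_not_zeroI)
    then show ?thesis using Suc.IH by blast
  qed
qed

subsection \<open>The Frobenius automorphism and norms\<close>

lemma prime_CHAR_finite: "prime CHAR('a::{field,finite})"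
  using prime_CHAR_semidom[where ?'a = 'a] finite_imp_CHAR_pos[where ?'a = 'a] by simp

text \<open>Cauchy's theorem for the additive group, taken from Sylow's theorem with exponent
  \<open>1\<close>: a nonzero \<open>x\<close> in a subgroup of order \<open>l\<close> forces
  \<open>of_nat l = 0\<close>.\<close>

lemma prime_dvd_CARD_imp_eq_CHAR:
  assumes "prime l" "l dvd CARD('a::{field,finite})"
  shows "l = CHAR('a)"
proof -
  define G where "G = \<lparr> carrier = (UNIV :: 'a set), monoid.mult = (+), one = (0 :: 'a) \<rparr>"
  have "group G"
  proof (rule groupI)
    fix x assume "x \<in> carrier G"
    show "\<exists>y\<in>carrier G. y \<otimes>\<^bsub>G\<^esub> x = \<one>\<^bsub>G\<^esub>"
      by (intro bexI[of _ "- x"]) (auto simp: G_def)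
  qed (auto simp: G_def add_ac)
  moreover obtain m where "CARD('a) = l ^ 1 * m" using assms(2) by auto
  then have "Coset.order G = l ^ 1 * m" by (simp add: Coset.order_def G_def)
  moreover have "finite (carrier G)" by (simp add: G_def)
  ultimately obtain H where "subgroup H G" and card: "card H = l ^ 1"
    using sylow_thm[OF assms(1)] by blast
  then interpret subgroup H G by simp
  have closed: "x + y \<in> H" if "x \<in> H" "y \<in> H" for x y
    using m_closed[OF that] by (simp add: G_def)
  have "card H > card {0 :: 'a}" using card prime_gt_1_nat[OF assms(1)] by simp
  then have "\<not> H \<subseteq> {0}" by (metis card_mono finite.emptyI finite.insertI not_le)
  then obtain x where x: "x \<in> H" "x \<noteq> 0" by blast
  \<comment> \<open>Translation by \<open>x\<close> permutes \<open>H\<close>; comparing the sums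
    over \<open>H\<close> before and after leaves \<open>of_nat l * x = 0\<close>.\<close>
  have "(+) x ` H = H"
    by (rule card_subset_eq) (auto simp: closed x card_image)
  then have "\<Sum>H = (\<Sum>y\<in>(+) x ` H. y)" by simp
  also have "\<dots> = (\<Sum>y\<in>H. x + y)" by (subst sum.reindex) auto
  also have "\<dots> = of_nat l * x + \<Sum>H" using card by (simp add: sum.distrib)
  finally have "of_nat l = (0 :: 'a)" using x by simp
  then have "CHAR('a) dvd l" by (simp add: of_nat_eq_0_iff_char_dvd)
  then show ?thesis using primes_dvd_imp_eq[OF prime_CHAR_finite[where ?'a = 'a] assms(1)] by simp
qed

text \<open>After removal of all factors \<open>CHAR('a)\<close>, a further prime divisor would
  again have to be \<open>CHAR('a)\<close>. This is what makes the q-power map additive.\<close>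

lemma CARD_eq_CHAR_power: "\<exists>k. CARD('a::{field,finite}) = CHAR('a) ^ k"
proof -
  have prime: "prime CHAR('a)" by (rule prime_CHAR_finite)
  then have "\<not> is_unit CHAR('a)" using not_prime_unit by blast
  then obtain y where y: "CARD('a) = CHAR('a) ^ multiplicity CHAR('a) CARD('a) * y" "\<not> CHAR('a) dvd y"
    using multiplicity_decompose'[of "CARD('a)" "CHAR('a)"] by auto
  have "y = 1"
  proof (rule ccontr)
    assume "y \<noteq> 1"
    then obtain l where "prime l" "l dvd y" using prime_factor_nat by blast
    moreover from this have "l dvd CARD('a)" using y(1) by (metis dvd_mult)
    ultimately have "l = CHAR('a)" using prime_dvd_CARD_imp_eq_CHAR by blast
    with \<open>l dvd y\<close> y(2) show False by simp
  qed
  with y(1) show ?thesis by (metis mult.right_neutral)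
qed

text \<open>Multiplication by a nonzero \<open>x\<close> permutes the nonzero elements; comparing
  their products gives \<open>x ^ (CARD('a) - 1) = 1\<close>.\<close>

lemma power_CARD_eq_same:
  fixes x :: "'a::{field,finite}"
  shows "x ^ CARD('a) = x"
proof (cases "x = 0")
  case False
  have "(*) x ` (UNIV - {0}) = UNIV - {0}"
    by (rule card_subset_eq) (use False in \<open>auto simp: card_image inj_on_def\<close>)
  then have "\<Prod>(UNIV - {0}) = (\<Prod>y\<in>(*) x ` (UNIV - {0}). y)" by simp
  also have "\<dots> = (\<Prod>y\<in>UNIV - {0}. x * y)"
    by (subst prod.reindex) (use False in \<open>auto simp: inj_on_def\<close>)
  also have "\<dots> = x ^ (CARD('a) - 1) * \<Prod>(UNIV - {0})"
    by (simp add: prod.distrib card_Diff_singleton)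
  finally have "x ^ (CARD('a) - 1) = 1" by simp
  moreover have "CARD('a) = Suc (CARD('a) - 1)" by simp
  ultimately show ?thesis by (metis mult.right_neutral power_Suc)
qed simp

lemma CARD_field_gt_1: "CARD('a::{field,finite}) > 1"
proof -
  have "card {0, 1 :: 'a} \<le> CARD('a)" by (rule card_mono) auto
  then show ?thesis by simp
qed

section \<open>Powers of the Frobenius map on the algebraic closure\<close>

definition frob :: "nat \<Rightarrow> 'a::{field,finite} alg_closure \<Rightarrow> 'a alg_closure"
  where "frob i a = a ^ (CARD('a) ^ i)"

lemma ring_map_frob: "ring_map (frob i :: 'a::{field,finite} alg_closure \<Rightarrow> _)"
proof
  obtain k where "CARD('a) = CHAR('a) ^ k" using CARD_eq_CHAR_power by blast
  then have "CARD('a) ^ i = CHAR('a alg_closure) ^ (k * i)" by (simp add: power_mult)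
  then show "frob i (a + b) = frob i a + frob i b" for a b :: "'a alg_closure"
    unfolding frob_def using prime_CHAR_finite[where ?'a = 'a] by (intro freshmans_dream') simp_all
qed (simp_all add: frob_def power_mult_distrib)

lemma inj_frob: "inj (frob i)"
  by (rule ring_map.injI[OF ring_map_frob]) (simp add: frob_def)

lemma frob_0: "frob 0 a = a"
  by (simp add: frob_def)

lemma frob_frob: "frob i (frob j a) = frob (i + j) a"
  by (simp add: frob_def power_add mult.commute flip: power_mult)

lemma frob_to_ac: "frob i (to_ac a) = to_ac a"
proof (induction i)
  case (Suc i)
  have "frob (Suc i) (to_ac a) = frob 1 (frob i (to_ac a))" by (simp add: frob_frob)
  also have "\<dots> = to_ac a" using Suc power_CARD_eq_same[of a] by (simp add: frob_def flip: to_ac_power)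
  finally show ?case .
qed (simp add: frob_0)

lemma frob_mult_fixed: "frob m a = a \<Longrightarrow> frob (m * n) a = a"
  by (induction n) (simp_all add: frob_0 flip: frob_frob)

text \<open>Fixed points are roots of X^q - X, which has at most q of them, and the embedded finite
  field already supplies q.\<close>

lemma frob_fixed_imp_in_range:
  fixes a :: "'a::{field,finite} alg_closure"
  assumes "frob 1 a = a"
  shows "a \<in> range to_ac"
proof -
  let ?q = "CARD('a)"
  define p where "p = monom (1 :: 'a alg_closure) ?q - monom 1 1"
  have root: "poly p x = 0 \<longleftrightarrow> frob 1 x = x" for x
    by (simp add: p_def poly_monom frob_def)
  have "coeff p ?q = 1" using CARD_field_gt_1[where ?'a = 'a] by (simp add: p_def)
  then have "p \<noteq> 0" by auto
  have "degree p \<le> ?q"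
    unfolding p_def using CARD_field_gt_1[where ?'a = 'a]
    by (intro degree_diff_le) (auto simp: degree_monom_eq)
  moreover have "card (range (to_ac :: 'a \<Rightarrow> _)) = ?q" by (rule card_image[OF inj_to_ac])
  ultimately have "card {x. poly p x = 0} \<le> card (range (to_ac :: 'a \<Rightarrow> _))"
    using card_poly_roots_bound[OF \<open>p \<noteq> 0\<close>] by simp
  moreover have "range to_ac \<subseteq> {x. poly p x = 0}" using root frob_to_ac by auto
  ultimately have "range to_ac = {x. poly p x = 0}"
    using poly_roots_finite[OF \<open>p \<noteq> 0\<close>] by (metis card_seteq)
  then show ?thesis using assms root by blast
qed

text \<open>All conjugates of \<open>a\<close> are roots of one nonzero polynomial over the finite
  field, so two of them coincide; injectivity of \<open>frob i\<close> cancels the lower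
  power.\<close>

lemma frob_eventually_fixes:
  fixes a :: "'a::{field,finite} alg_closure"
  shows "\<exists>m>0. frob m a = a"
proof -
  obtain p :: "'a poly" where p: "p \<noteq> 0" "poly (map_poly to_ac p) a = 0"
    by (rule alg_closure_algebraic)
  let ?p = "map_poly to_ac p"
  have "?p \<noteq> 0" using p(1) by (simp add: map_poly_eq_0_iff)
  then have fin: "finite {x. poly ?p x = 0}" by (rule poly_roots_finite)
  have "poly ?p (frob i a) = 0" for i
  proof -
    interpret ring_map "frob i :: 'a alg_closure \<Rightarrow> _" by (rule ring_map_frob)
    have "poly ?p (frob i a) = frob i (poly ?p a)"
      by (simp add: poly_altdef map_sum map_mult map_power coeff_map_poly frob_to_ac)
    then show ?thesis using p(2) by (simp add: map_zero)
  qed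
  then have "range (\<lambda>i. frob i a) \<subseteq> {x. poly ?p x = 0}" by auto
  then have "finite (range (\<lambda>i. frob i a))" using fin finite_subset by blast
  then have "\<not> inj (\<lambda>i. frob i a)" using finite_imageD by blast
  then obtain i j where "frob i a = frob j a" "i < j"
    unfolding inj_def by (metis linorder_neqE_nat)
  then have "frob i (frob (j - i) a) = frob i a" by (simp add: frob_frob)
  then have "frob (j - i) a = a" using injD[OF inj_frob] by blast
  with \<open>i < j\<close> show ?thesis by (intro exI[of _ "j - i"]) simp
qed

lemma frob_eventually_fixes_finite:
  "finite A \<Longrightarrow> \<exists>m>0. \<forall>a\<in>A. frob m a = a"
proof (induction A rule: finite_induct)
  case (insert a A)
  then obtain m where m: "m > 0" "\<forall>a\<in>A. frob m a = a" by blast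
  obtain n where n: "n > 0" "frob n a = a" using frob_eventually_fixes by blast
  have "frob (n * m) a = a" "\<forall>a\<in>A. frob (m * n) a = a" using m n frob_mult_fixed by auto
  then show ?case using m n by (intro exI[of _ "m * n"]) (auto simp: mult.commute)
qed auto

text \<open>In use, \<open>m\<close> is some common period of the coefficients, not necessarily the
  least, so this may be a power of the usual norm. That freedom lets one \<open>m\<close> serve two
  factors.\<close>

definition mpoly_norm :: "nat \<Rightarrow> ('d, 'a::{field,finite} alg_closure) mpolynomial \<Rightarrow> ('d, 'a alg_closure) mpolynomial"
  where "mpoly_norm m g = (\<Prod>i<m. Poly_Mapping.map (frob i) g)"

lemma ring_map_to_ac: "ring_map to_ac"
  by unfold_locales simp_all

text \<open>Frobenius shifts the factors cyclically, as the conjugate with index \<open>m\<close> is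
  the one with index \<open>0\<close>. Hence the coefficients of the product are fixed and lie in
  the finite field.\<close>

lemma mpoly_norm_in_range:
  fixes g :: "('d, 'a::{field,finite} alg_closure) mpolynomial"
  assumes m: "m > 0" "\<And>e. frob m (Poly_Mapping.lookup g e) = Poly_Mapping.lookup g e"
  shows "\<exists>n. Poly_Mapping.map to_ac n = mpoly_norm m g"
proof -
  interpret F: ring_map "Poly_Mapping.map (frob 1) :: ('d, 'a alg_closure) mpolynomial \<Rightarrow> _"
    by (rule ring_map.ring_map_mpoly_map[OF ring_map_frob])
  let ?g = "\<lambda>i. Poly_Mapping.map (frob i) g"
  have Suc: "Poly_Mapping.map (frob 1) (?g i) = ?g (Suc i)" for i
    by (rule poly_mapping_eqI) (simp add: ring_map.lookup_map[OF ring_map_frob] frob_frob)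
  have "?g m = ?g 0"
    by (rule poly_mapping_eqI) (simp add: ring_map.lookup_map[OF ring_map_frob] m frob_0)
  moreover obtain l where l: "m = Suc l" using m(1) by (cases m) auto
  moreover have "(\<Prod>i<m. ?g (Suc i)) = (\<Prod>i<l. ?g (Suc i)) * ?g m"
    unfolding l by (rule prod.lessThan_Suc)
  ultimately have "(\<Prod>i<m. ?g (Suc i)) = ?g 0 * (\<Prod>i<l. ?g (Suc i))"
    by (simp only: mult.commute)
  also have "\<dots> = mpoly_norm m g"
    unfolding mpoly_norm_def l by (rule prod.lessThan_Suc_shift[symmetric])
  finally have "(\<Prod>i<m. ?g (Suc i)) = mpoly_norm m g" .
  then have "Poly_Mapping.map (frob 1) (mpoly_norm m g) = mpoly_norm m g"
    by (simp only: mpoly_norm_def F.map_prod Suc)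
  then have "frob 1 (Poly_Mapping.lookup (mpoly_norm m g) e) = Poly_Mapping.lookup (mpoly_norm m g) e" for e
    by (metis ring_map.lookup_map[OF ring_map_frob])
  then have "Poly_Mapping.lookup (mpoly_norm m g) e \<in> range to_ac" for e
    by (rule frob_fixed_imp_in_range)
  then have "to_ac (of_ac (Poly_Mapping.lookup (mpoly_norm m g) e)) = Poly_Mapping.lookup (mpoly_norm m g) e" for e
    by (rule to_ac_of_ac)
  moreover have "Poly_Mapping.lookup (Poly_Mapping.map of_ac (mpoly_norm m g)) e =
      of_ac (Poly_Mapping.lookup (mpoly_norm m g) e)" for e
    by (simp add: Poly_Mapping.map.rep_eq when_def)
  ultimately have "Poly_Mapping.map to_ac (Poly_Mapping.map of_ac (mpoly_norm m g)) = mpoly_norm m g"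
    by (intro poly_mapping_eqI) (simp add: ring_map.lookup_map[OF ring_map_to_ac])
  then show ?thesis by blast
qed

subsection \<open>Matrix pencils\<close>

lemma (in ring_map) map_det:
  fixes A :: "'s^'n^'n"
  shows "h (det A) = det (\<chi> i j. h (A $ i $ j))"
  unfolding det_def by (simp add: map_sum map_mult map_of_int map_prod)

text \<open>Entry \<open>(k, j)\<close> of the adjugate is the determinant of \<open>Z\<close> with
  row \<open>j\<close> replaced by the unit vector \<open>k\<close>. By linearity in that row, entry
  \<open>(i, j)\<close> of the product is the determinant of \<open>Z\<close> with row
  \<open>j\<close> replaced by row \<open>i\<close>: it is \<open>det Z\<close> for
  \<open>i = j\<close>, and \<open>0\<close> otherwise by equal rows.\<close>

lemma exists_adjugate:
  fixes Z :: "'s::comm_ring_1^'n^'n"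
  shows "\<exists>Y. Z ** Y = mat (det Z)"
proof -
  define Y where "Y = (\<chi> k j. det (\<chi> l. if l = j then axis k 1 else Z $ l))"
  have "(Z ** Y) $ i $ j = mat (det Z) $ i $ j" for i j
  proof -
    have "(Z ** Y) $ i $ j = (\<Sum>k\<in>UNIV. det (\<chi> l. if l = j then Z $ i $ k *s axis k 1 else Z $ l))"
      by (simp add: Y_def matrix_matrix_mult_def det_row_mul)
    also have "\<dots> = det (\<chi> l. if l = j then (\<Sum>k\<in>UNIV. Z $ i $ k *s axis k 1) else Z $ l)"
      by (subst det_linear_row_sum) auto
    also have "(\<Sum>k\<in>UNIV. Z $ i $ k *s axis k 1) = Z $ i"
      by (simp add: vec_eq_iff axis_def if_distrib cong: if_cong)
    also have "det (\<chi> l. if l = j then Z $ i else Z $ l) = mat (det Z) $ i $ j"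
    proof (cases "i = j")
      case True
      then have "(\<chi> l. if l = j then Z $ i else Z $ l) = Z" by (simp add: vec_eq_iff)
      then show ?thesis using True by (simp add: mat_def)
    next
      case False
      then have "det (\<chi> l. if l = j then Z $ i else Z $ l) = 0"
        by (intro det_identical_rows[of i j]) (auto simp: row_def vec_eq_iff)
      then show ?thesis using False by (simp add: mat_def)
    qed
    finally show ?thesis .
  qed
  then have "Z ** Y = mat (det Z)" by (simp add: vec_eq_iff)
  then show ?thesis by blast
qed

definition pencil :: "'a::comm_ring_1^'n^'n \<Rightarrow> 'a^'n^'n \<Rightarrow> 'a poly^'n^'n"
  where "pencil A B = (\<chi> i j. [:B $ i $ j, A $ i $ j:])"

text \<open>The coefficient at \<open>card S\<close> takes the place of the leading one, because
  factors with \<open>a i = 0\<close> lower the degree.\<close>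

lemma prod_linear_polys:
  fixes a b :: "'i \<Rightarrow> 'a::comm_ring_1"
  assumes "finite S"
  shows "degree (\<Prod>i\<in>S. [:b i, a i:]) \<le> card S \<and> coeff (\<Prod>i\<in>S. [:b i, a i:]) (card S) = (\<Prod>i\<in>S. a i)"
  using assms
proof (induction S rule: finite_induct)
  case (insert x S)
  let ?p = "\<Prod>i\<in>S. [:b i, a i:]"
  have "degree ([:b x, a x:] * ?p) \<le> degree [:b x, a x:] + degree ?p" by (rule degree_mult_le)
  also have "\<dots> \<le> Suc (card S)" using insert.IH by auto
  finally have "degree ([:b x, a x:] * ?p) \<le> Suc (card S)" .
  moreover have "coeff ?p (Suc (card S)) = 0" using insert.IH by (intro coeff_eq_0) auto
  ultimately show ?case using insert by (simp add: coeff_pCons)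
qed simp

lemma degree_det_pencil: "degree (det (pencil A B)) \<le> CARD('n)"
  and coeff_det_pencil: "coeff (det (pencil A B)) CARD('n) = det (A :: 'a::comm_ring_1^'n^'n)"
proof -
  let ?P = "{p. p permutes (UNIV :: 'n set)}"
  let ?t = "\<lambda>p. \<Prod>i\<in>UNIV. [:B $ i $ p i, A $ i $ p i:]"
  have det: "det (pencil A B) = (\<Sum>p\<in>?P. [:of_int (sign p):] * ?t p)"
    by (simp only: det_def pencil_def vec_lambda_beta of_int_poly)
  have t: "degree (?t p) \<le> CARD('n)" "coeff (?t p) CARD('n) = (\<Prod>i\<in>UNIV. A $ i $ p i)" for p
    using prod_linear_polys[OF finite_class.finite_UNIV, of "\<lambda>i. B $ i $ p i" "\<lambda>i. A $ i $ p i"] by auto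
  show "degree (det (pencil A B)) \<le> CARD('n)"
    unfolding det
  proof (rule degree_sum_le)
    fix p
    show "degree ([:of_int (sign p):] * ?t p) \<le> CARD('n)"
      using t(1)[of p] degree_smult_le[of "of_int (sign p)" "?t p"] by simp
  qed simp
  show "coeff (det (pencil A B)) CARD('n) = det A"
    unfolding det by (simp add: coeff_sum t(2) det_def)
qed

lemma poly_det_pencil_0: "poly (det (pencil A B)) 0 = det B"
  by (simp add: ring_map.map_det[OF ring_map_poly] pencil_def)

section \<open>Nilpotency from a monomial determinant\<close>

lemma funpow_matrix_mult:
  fixes N :: "'a::semiring_1^'n^'n"
  shows "((**) N ^^ k) Z = ((**) N ^^ k) (mat 1) ** Z"
  by (induction k) (simp_all add: matrix_mul_assoc)

lemma mat_mult_mat: "mat a ** mat b = (mat (a * b) :: 'a::semiring_1^'n^'n)"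
proof -
  have "(mat a ** mat b :: 'a^'n^'n) $ i $ j = mat (a * b) $ i $ j" for i j
  proof -
    have "(mat a ** mat b :: 'a^'n^'n) $ i $ j =
        (\<Sum>k\<in>UNIV. if k = i then a * (if i = j then b else 0) else 0)"
      unfolding matrix_matrix_mult_def mat_def vec_lambda_beta by (rule sum.cong) auto
    then show ?thesis by (simp add: mat_def)
  qed
  then show ?thesis by (simp add: vec_eq_iff)
qed

lemma matrix_inv_mult_left:
  fixes A :: "'a::field^'n^'n"
  assumes "det A \<noteq> 0"
  shows "matrix_inv A ** A = mat 1"
proof -
  have "\<exists>A'. A ** A' = mat 1 \<and> A' ** A = mat 1"
    using assms invertible_det_nz[of A] by (simp add: invertible_def)
  from someI_ex[OF this] show ?thesis by (simp add: matrix_inv_def)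
qed

text \<open>Comparing the coefficients of \<open>x\<^sup>i\<close> in \<open>(xA + B) Y = c x\<^sup>n I\<close>, with \<open>Y\<close> the adjugate of
  \<open>xA + B\<close>, expresses each coefficient of \<open>Y\<close> through the next one.\<close>

lemma nilpotent_matrix_pencil:
  fixes A B :: "'a::field^'n^'n"
  assumes A: "det A \<noteq> 0" and det: "det (pencil A B) = monom c CARD('n)" and c: "c \<noteq> 0"
  shows "nilpotent_matrix (matrix_inv A ** B)"
proof -
  obtain Y where Y: "pencil A B ** Y = mat (monom c CARD('n))"
    using exists_adjugate[of "pencil A B"] det by auto
  define C where "C m = (\<chi> i j. coeff (Y $ i $ j) m)" for m
  define N where "N = matrix_inv A ** B"
  have mult0: "B ** C 0 = 0"
  proof -
    have "coeff ((pencil A B ** Y) $ i $ j) 0 = 0" for i j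
      unfolding Y by (simp add: mat_def)
    then show ?thesis
      by (simp add: vec_eq_iff matrix_matrix_mult_def pencil_def C_def coeff_sum)
  qed
  have mult_Suc: "B ** C (Suc m) + A ** C m = (if Suc m = CARD('n) then mat c else 0)" for m
  proof -
    have "coeff ((pencil A B ** Y) $ i $ j) (Suc m) = (if Suc m = CARD('n) then mat c else 0) $ i $ j" for i j
      unfolding Y by (simp add: mat_def)
    then show ?thesis
      by (simp add: vec_eq_iff matrix_matrix_mult_def pencil_def C_def coeff_sum sum.distrib)
  qed
  define d where "d = Max (range (\<lambda>(i, j). degree (Y $ i $ j)))"
  have large: "C m = 0" if "m > d" for m
  proof -
    have "degree (Y $ i $ j) \<le> d" for i j
      unfolding d_def by (rule Max_ge) (auto intro: rev_image_eqI[of "(i, j)"])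
    then have "coeff (Y $ i $ j) m = 0" for i j
      using le_less_trans that by (intro coeff_eq_0) blast
    then show ?thesis by (simp add: C_def vec_eq_iff)
  qed
  have A_cancel: "Z = 0" if "A ** Z = 0" for Z :: "'a^'n^'n"
  proof -
    have "Z = (matrix_inv A ** A) ** Z" using matrix_inv_mult_left[OF A] by simp
    also have "\<dots> = matrix_inv A ** 0" using that by (simp flip: matrix_mul_assoc)
    finally show ?thesis by simp
  qed
  \<comment> \<open>Downward induction from the degree bound \<open>d\<close>: in this range the
    relation reads \<open>B ** C (Suc m) + A ** C m = 0\<close>, and \<open>A\<close> is
    invertible.\<close>
  have zero: "C m = 0" if "m \<ge> CARD('n)" for m
    using that
  proof (induction "Suc d - m" arbitrary: m)
    case 0
    then show ?case by (intro large) simp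
  next
    case (Suc k)
    then have "C (Suc m) = 0" by (intro Suc.hyps(1)) auto
    with mult_Suc[of m] Suc.prems have "A ** C m = 0" by simp
    then show ?case by (rule A_cancel)
  qed
  obtain n where n: "CARD('n) = Suc n" using not0_implies_Suc[of "CARD('n)"] by auto
  \<comment> \<open>The only relation with nonzero right-hand side makes the last possibly nonzero
    coefficient \<open>C n\<close>, with \<open>n = CARD('n) - 1\<close>, invertible.\<close>
  have "A ** C n = mat c" using mult_Suc[of n] zero[of "Suc n"] n by simp
  then have "A ** (C n ** mat (inverse c)) = mat 1" using c by (simp add: matrix_mul_assoc mat_mult_mat)
  then have inv: "C n ** (mat (inverse c) ** A) = mat 1"
    using matrix_left_right_inverse1 by (metis matrix_mul_assoc)
  have NC: "N ** C (Suc m) + C m = 0" if "m < n" for m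
  proof -
    have "N ** C (Suc m) + C m = matrix_inv A ** (B ** C (Suc m) + A ** C m)"
      using matrix_inv_mult_left[OF A] by (simp add: N_def matrix_add_ldistrib matrix_mul_assoc)
    then show ?thesis using mult_Suc[of m] that n by simp
  qed
  let ?P = "\<lambda>k. ((**) N ^^ k) (mat 1)"
  have Suc': "?P (Suc k) ** Z = ?P k ** (N ** Z)" for k and Z :: "'a^'n^'n"
    using funpow_matrix_mult[of "Suc k" N Z] funpow_matrix_mult[of k N "N ** Z"] by (simp add: funpow_swap1)
  \<comment> \<open>Upward from \<open>B ** C 0 = 0\<close>: as
    \<open>C m = - (N ** C (Suc m))\<close>, each step costs one more power of \<open>N\<close>. At
    \<open>m = n\<close> the invertible \<open>C n\<close> cancels, so the power
    \<open>CARD('n)\<close> of \<open>N\<close> vanishes.\<close>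
  have "?P (Suc m) ** C m = 0" if "m \<le> n" for m
    using that
  proof (induction m)
    case 0
    then show ?case unfolding Suc' using mult0 by (simp add: N_def flip: matrix_mul_assoc)
  next
    case (Suc m)
    have "?P (Suc m) ** (N ** C (Suc m) + C m) = 0" using NC Suc.prems by simp
    then have "?P (Suc m) ** (N ** C (Suc m)) + ?P (Suc m) ** C m = 0" by (simp only: matrix_add_ldistrib)
    moreover have "?P (Suc m) ** C m = 0" using Suc by simp
    ultimately show ?case unfolding Suc'[of "Suc m"] by simp
  qed
  then have "?P (Suc n) ** C n = 0" by simp
  then have "?P (Suc n) ** (C n ** (mat (inverse c) ** A)) = 0" by (simp only: matrix_mul_assoc) simp
  then have "?P (Suc n) = 0" unfolding inv by simp
  then show ?thesis unfolding nilpotent_matrix_def N_def by blast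
qed

subsection \<open>Restriction to a rational line\<close>

lemma ring_map_map_poly: "ring_map h \<Longrightarrow> ring_map (map_poly h)"
proof -
  assume "ring_map h"
  then interpret ring_map h .
  have coeff: "coeff (map_poly h p) i = h (coeff p i)" for p i
    by (rule coeff_map_poly) (rule map_zero)
  show ?thesis
    by unfold_locales
      (auto intro!: poly_eqI simp: coeff coeff_mult map_add map_mult map_sum map_one map_zero)
qed

lemma degree_map_poly_inj:
  assumes "inj h" "h 0 = 0"
  shows "degree (map_poly h p) = degree p"
  by (rule degree_map_poly) (metis assms injD)

lemma map_poly_inj_nonzero:
  assumes "inj h" "h 0 = 0" "p \<noteq> 0"
  shows "map_poly h p \<noteq> 0"
proof -
  have "lead_coeff (map_poly h p) = h (lead_coeff p)"
    using assms by (simp add: coeff_map_poly degree_map_poly_inj)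
  moreover have "h (lead_coeff p) \<noteq> 0" using assms by (metis injD leading_coeff_0_iff)
  ultimately show ?thesis by force
qed

text \<open>The order at \<open>0\<close> counts the vanishing lowest coefficients, and
  \<open>h\<close> vanishes only at \<open>0\<close>. At another point, the point itself could be
  moved by \<open>h\<close>.\<close>

lemma order_0_map_poly_inj:
  fixes h :: "'s::idom \<Rightarrow> 't::idom"
  assumes h: "inj h" "h 0 = 0" and p: "p \<noteq> 0"
  shows "order 0 (map_poly h p) = order 0 p"
proof -
  have nz: "h a = 0 \<longleftrightarrow> a = 0" for a using h by (metis injD)
  have "map_poly h p \<noteq> 0" by (rule map_poly_inj_nonzero[OF h p])
  moreover have "monom 1 n dvd map_poly h p \<longleftrightarrow> monom 1 n dvd p" for n
    by (simp add: monom_1_dvd_iff' coeff_map_poly h(2) nz)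
  ultimately show ?thesis using p by (metis monom_1_dvd_iff order.antisym order.refl)
qed

lemma order_prod_eq:
  fixes f :: "'i \<Rightarrow> 's::idom poly"
  shows "(\<And>i. i \<in> I \<Longrightarrow> f i \<noteq> 0) \<Longrightarrow> order a (\<Prod>i\<in>I. f i) = (\<Sum>i\<in>I. order a (f i))"
  by (induction I rule: infinite_finite_induct) (auto simp: order_mult order_0I)

text \<open>In use, \<open>a\<close> and \<open>b\<close> are the coordinates of \<open>A\<close>
  and \<open>B\<close>, so the parameter value \<open>0\<close> is the singular matrix.\<close>

definition mpoly_line ::
    "('d::finite \<Rightarrow> 'a::comm_ring_1) \<Rightarrow> ('d \<Rightarrow> 'a) \<Rightarrow> ('d, 'a) mpolynomial \<Rightarrow> 'a poly"
  where "mpoly_line b a = mpoly_subst (\<lambda>c. [:c:]) (\<lambda>k. [:b k, a k:])"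

lemma ring_map_const_poly: "ring_map (\<lambda>c. [:c:])"
  by unfold_locales (simp_all add: one_pCons)

lemma ring_map_mpoly_line: "ring_map (mpoly_line b a)"
  unfolding mpoly_line_def by (rule ring_map.ring_map_mpoly_subst[OF ring_map_const_poly])

lemma mpoly_line_const: "mpoly_line b a (mpoly_const c) = [:c:]"
  by (simp add: mpoly_line_def ring_map.mpoly_subst_const[OF ring_map_const_poly])

lemma mpoly_line_var: "mpoly_line b a (mpoly_var k) = [:b k, a k:]"
  by (simp add: mpoly_line_def ring_map.mpoly_subst_var[OF ring_map_const_poly])

text \<open>Both sides are ring homomorphisms in \<open>p\<close> that agree on constants and
  variables. Frobenius fixes a line with coordinates in the finite field, so conjugating a
  polynomial conjugates its restriction.\<close>

lemma mpoly_line_map: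
  assumes h: "ring_map h"
  shows "mpoly_line (\<lambda>k. h (b k)) (\<lambda>k. h (a k)) (Poly_Mapping.map h p) = map_poly h (mpoly_line b a p)"
proof -
  interpret ring_map h by (rule h)
  show ?thesis
  proof (rule ring_map_mpoly_eqI[where p = p])
    show "ring_map (\<lambda>p. mpoly_line (\<lambda>k. h (b k)) (\<lambda>k. h (a k)) (Poly_Mapping.map h p))"
      by (rule ring_map_comp[OF ring_map_mpoly_line ring_map_mpoly_map])
    show "ring_map (\<lambda>p. map_poly h (mpoly_line b a p))"
      by (rule ring_map_comp[OF ring_map_map_poly[OF h] ring_map_mpoly_line])
  qed (simp_all add: map_mpoly_const map_mpoly_var mpoly_line_const mpoly_line_var map_poly_pCons map_zero)
qed

text \<open>As the prime \<open>p\<close> is the only one dividing the norm of a factor \<open>g\<close> of \<open>p\<close>, that norm is a power of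
  \<open>p\<close>; the Frobenius automorphism changes neither degrees nor vanishing orders along a rational line.\<close>

lemma mpoly_norm_degree_order:
  fixes p :: "('d::finite, 'a::{field,finite}) mpolynomial" and g :: "('d, 'a alg_closure) mpolynomial"
  assumes p: "prime_elem p" and m: "m > 0"
    and n: "Poly_Mapping.map to_ac n = mpoly_norm m g" and dvd: "n * n' = p ^ l" and g: "\<not> g dvd 1"
    and nz: "mpoly_line b a p \<noteq> 0"
      "mpoly_line (\<lambda>k. to_ac (b k)) (\<lambda>k. to_ac (a k)) g \<noteq> 0"
  shows "\<exists>k>0.
    m * degree (mpoly_line (\<lambda>k. to_ac (b k)) (\<lambda>k. to_ac (a k)) g) = k * degree (mpoly_line b a p) \<and>
    m * order 0 (mpoly_line (\<lambda>k. to_ac (b k)) (\<lambda>k. to_ac (a k)) g) = k * order 0 (mpoly_line b a p)"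
proof -
  let ?L = "mpoly_line b a"
  let ?K = "mpoly_line (\<lambda>k. to_ac (b k)) (\<lambda>k. to_ac (a k))"
  interpret L: ring_map ?L by (rule ring_map_mpoly_line)
  interpret K: ring_map ?K by (rule ring_map_mpoly_line)
  interpret C: ring_map "Poly_Mapping.map to_ac :: ('d, 'a) mpolynomial \<Rightarrow> _"
    by (rule ring_map.ring_map_mpoly_map[OF ring_map_to_ac])
  obtain u k where u: "n = u * p ^ k" "u dvd 1" using prime_elem_mult_eq_power[OF p dvd] by blast
  \<comment> \<open>The conjugate with index \<open>0\<close> is \<open>g\<close> itself, so
    \<open>g\<close> divides its norm; for \<open>k = 0\<close> the norm, and with it
    \<open>g\<close>, would be a unit.\<close>
  have "k > 0"
  proof (rule ccontr)
    assume "\<not> k > 0"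
    with u have "n dvd 1" by simp
    then have "mpoly_norm m g dvd 1" using C.map_dvd[of n 1] n by (simp add: C.map_one)
    moreover have "Poly_Mapping.map (frob 0) g = g"
      by (rule poly_mapping_eqI) (simp add: ring_map.lookup_map[OF ring_map_frob] frob_0)
    then have "g dvd mpoly_norm m g"
      unfolding mpoly_norm_def using m by (metis dvd_prodI finite_lessThan lessThan_iff)
    ultimately show False using g dvd_trans by blast
  qed
  \<comment> \<open>A unit restricts to a nonzero constant, which affects neither degree nor
    order.\<close>
  have "?L u dvd 1" using L.map_dvd[OF u(2)] by (simp add: L.map_one)
  then have Lu: "degree (?L u) = 0" "?L u \<noteq> 0" using dvd_imp_degree_le[of "?L u" 1] by auto
  have Lu_order: "order 0 (?L u) = 0"
    using order_degree[OF Lu(2), of 0] Lu(1) by simp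
  have Ln: "?L n = ?L u * ?L p ^ k" by (simp add: u(1) L.map_mult L.map_power)
  have frob: "?K (Poly_Mapping.map (frob i) g) = map_poly (frob i) (?K g)" for i
    using mpoly_line_map[OF ring_map_frob, of i "\<lambda>k. to_ac (b k)" "\<lambda>k. to_ac (a k)" g] by (simp add: frob_to_ac)
  have "map_poly to_ac (?L n) = ?K (mpoly_norm m g)"
    using mpoly_line_map[OF ring_map_to_ac, of b a n] n by simp
  also have "\<dots> = (\<Prod>i<m. map_poly (frob i) (?K g))"
    by (simp only: mpoly_norm_def K.map_prod frob)
  finally have norm: "map_poly to_ac (?L n) = (\<Prod>i<m. map_poly (frob i) (?K g))" .
  have frob_zero: "frob i 0 = (0 :: 'a alg_closure)" for i by (rule ring_map.map_zero[OF ring_map_frob])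
  have nz_frob: "map_poly (frob i) (?K g) \<noteq> 0" for i
    by (rule map_poly_inj_nonzero[OF inj_frob frob_zero nz(2)])
  \<comment> \<open>Degree, and below also order, turn the product of \<open>m\<close> conjugates
    into \<open>m\<close> equal summands.\<close>
  have "degree (?L n) = m * degree (?K g)"
    using arg_cong[OF norm, of degree] nz_frob
    by (simp add: degree_prod_sum_eq degree_map_poly_inj inj_to_ac inj_frob frob_zero)
  moreover have "degree (?L n) = k * degree (?L p)"
    unfolding Ln using Lu nz(1) by (simp add: degree_mult_eq degree_power_eq)
  moreover have "?L n \<noteq> 0" unfolding Ln using Lu nz(1) by simp
  then have "order 0 (?L n) = m * order 0 (?K g)"
    using arg_cong[OF norm, of "order 0"] nz_frob nz(2)
    by (simp add: order_prod_eq order_0_map_poly_inj inj_to_ac inj_frob frob_zero)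
  moreover have "order 0 (?L n) = k * order 0 (?L p)"
  proof -
    have "order 0 (?L p ^ k) = k * order 0 (?L p)"
      using order_prod_eq[of "{..<k}" "\<lambda>_. ?L p" 0] nz(1) by simp
    then show ?thesis unfolding Ln using Lu nz(1) Lu_order by (simp add: order_mult)
  qed
  ultimately show ?thesis using \<open>k > 0\<close> by auto
qed

lemma order_mpoly_line_eq_degree:
  fixes p :: "('d::finite, 'a::{field,finite}) mpolynomial"
  assumes irr: "irreducible p" and not_abs: "\<not> absolutely_irreducible p"
    and r: "prime (degree (mpoly_line b a p))" and root: "poly (mpoly_line b a p) 0 = 0"
  shows "order 0 (mpoly_line b a p) = degree (mpoly_line b a p)"
proof -
  let ?f = "mpoly_line b a p" and ?p = "Poly_Mapping.map to_ac p"
  let ?K = "mpoly_line (\<lambda>k. to_ac (b k)) (\<lambda>k. to_ac (a k))"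
  interpret K: ring_map ?K by (rule ring_map_mpoly_line)
  interpret C: ring_map "Poly_Mapping.map to_ac :: ('d, 'a) mpolynomial \<Rightarrow> _"
    by (rule ring_map.ring_map_mpoly_map[OF ring_map_to_ac])
  have f_nz: "?f \<noteq> 0" using r by auto
  have Kp: "?K ?p = map_poly to_ac ?f" by (rule mpoly_line_map[OF ring_map_to_ac])
  have deg: "degree (?K ?p) = degree ?f"
    unfolding Kp by (rule degree_map_poly_inj[OF inj_to_ac to_ac_0])
  have Kp_nz: "?K ?p \<noteq> 0" using deg r by auto
  \<comment> \<open>Failure of irreducibility yields two nonunit factors only for a nonzero nonunit;
    both properties are seen on the line, where the degree is prime and so positive.\<close>
  have "?p \<noteq> 0" using Kp_nz K.map_zero by auto
  moreover have "\<not> ?p dvd 1"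
  proof
    assume "?p dvd 1"
    then have "?K ?p dvd 1" using K.map_dvd K.map_one by metis
    then show False using dvd_imp_degree_le[of "?K ?p" 1] deg r by simp
  qed
  ultimately obtain g h where gh: "?p = g * h" "\<not> g dvd 1" "\<not> h dvd 1"
    using not_abs Factorial_Ring.irreducibleI[of ?p] unfolding absolutely_irreducible_def by blast
  have Kgh: "?K ?p = ?K g * ?K h" by (simp add: gh(1) K.map_mult)
  with Kp_nz have nz: "?K g \<noteq> 0" "?K h \<noteq> 0" by auto
  \<comment> \<open>A single period for the coefficients of both factors, so that the two norms
    multiply to \<open>?p ^ m\<close>.\<close>
  let ?A = "Poly_Mapping.lookup g ` Poly_Mapping.keys g \<union> Poly_Mapping.lookup h ` Poly_Mapping.keys h"
  obtain m where m: "m > 0" "\<forall>c\<in>?A. frob m c = c"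
    using frob_eventually_fixes_finite[of ?A] by auto
  have frob_zero: "frob i 0 = (0 :: 'a alg_closure)" for i by (rule ring_map.map_zero[OF ring_map_frob])
  have "frob m (Poly_Mapping.lookup g e) = Poly_Mapping.lookup g e"
    "frob m (Poly_Mapping.lookup h e) = Poly_Mapping.lookup h e" for e
    using m(2) frob_zero by (cases "e \<in> Poly_Mapping.keys g"; cases "e \<in> Poly_Mapping.keys h"; simp add: in_keys_iff)+
  then obtain ng nh where n: "Poly_Mapping.map to_ac ng = mpoly_norm m g" "Poly_Mapping.map to_ac nh = mpoly_norm m h"
    using mpoly_norm_in_range m(1) by metis
  have "Poly_Mapping.map (frob i) ?p = ?p" for i
    by (rule poly_mapping_eqI)
      (simp add: ring_map.lookup_map[OF ring_map_frob] ring_map.lookup_map[OF ring_map_to_ac] frob_to_ac)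
  then have "?p ^ m = (\<Prod>i<m. Poly_Mapping.map (frob i) ?p)" by simp
  also have "\<dots> = mpoly_norm m g * mpoly_norm m h"
    unfolding gh(1) mpoly_norm_def
    by (simp add: prod.distrib ring_map.map_mult[OF ring_map.ring_map_mpoly_map[OF ring_map_frob]])
  finally have "Poly_Mapping.map to_ac (ng * nh) = Poly_Mapping.map to_ac (p ^ m)"
    by (simp add: C.map_mult C.map_power n)
  then have "to_ac (Poly_Mapping.lookup (ng * nh) e) = to_ac (Poly_Mapping.lookup (p ^ m) e)" for e
    unfolding ring_map.lookup_map[OF ring_map_to_ac, symmetric] by simp
  then have norm: "ng * nh = p ^ m" by (intro poly_mapping_eqI) simp
  have prime: "prime_elem p" by (rule irreducible_mpoly_prime_elem[OF irr])
  obtain k where k: "k > 0" "m * degree (?K g) = k * degree ?f" "m * order 0 (?K g) = k * order 0 ?f"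
    using mpoly_norm_degree_order[OF prime m(1) n(1) norm gh(2) f_nz nz(1)] by blast
  obtain l where l: "l > 0" "m * degree (?K h) = l * degree ?f"
    using mpoly_norm_degree_order[OF prime m(1) n(2) _ gh(3) f_nz nz(2), of ng m] norm by (auto simp: mult.commute)
  have sum: "degree (?K g) + degree (?K h) = degree ?f"
    using deg Kgh nz by (simp add: degree_mult_eq)
  have pos: "degree ?f > 0" using r prime_gt_0_nat by blast
  have nz_deg: "m * degree (?K g) > 0" "m * degree (?K h) > 0"
    unfolding k(2) l(2) using k(1) l(1) pos by simp_all
  then have "degree (?K g) > 0" "degree (?K h) > 0" using nz_deg by simp_all
  with sum have "\<not> degree ?f dvd degree (?K g)" by (auto dest: dvd_imp_le)
  moreover have "degree ?f dvd degree (?K g) * order 0 ?f"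
  proof -
    \<comment> \<open>The same \<open>m\<close> and \<open>k\<close> govern degree and order:
      \<open>k\<close> is eliminated between the two equations, and \<open>m\<close>
      cancels.\<close>
    have "m * (degree (?K g) * order 0 ?f) = (k * degree ?f) * order 0 ?f"
      unfolding k(2)[symmetric] by simp
    also have "\<dots> = degree ?f * (k * order 0 ?f)" by simp
    also have "\<dots> = m * (degree ?f * order 0 (?K g))" unfolding k(3)[symmetric] by simp
    finally have "degree (?K g) * order 0 ?f = degree ?f * order 0 (?K g)" using m(1) by simp
    then show ?thesis by simp
  qed
  ultimately have "degree ?f dvd order 0 ?f" using r prime_dvd_mult_iff by blast
  moreover have "order 0 ?f > 0" using root f_nz order_root by blast
  ultimately have "degree ?f \<le> order 0 ?f" by (rule dvd_imp_le)
  then show ?thesis using order_degree[OF f_nz, of 0] by simp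
qed

section \<open>The determinantal polynomial on a line\<close>

lemma mpoly_line_det_polynomial:
  "mpoly_line b a (det_polynomial Ms) =
    det (pencil (\<Sum>k\<in>UNIV. matrix_scale (a k) (Ms k)) (\<Sum>k\<in>UNIV. matrix_scale (b k) (Ms k)))"
proof -
  interpret ring_map "mpoly_line b a" by (rule ring_map_mpoly_line)
  have "mpoly_line b a (\<Sum>k\<in>UNIV. mpoly_var k * mpoly_const (Ms k $ i $ j)) =
      [:(\<Sum>k\<in>UNIV. matrix_scale (b k) (Ms k)) $ i $ j, (\<Sum>k\<in>UNIV. matrix_scale (a k) (Ms k)) $ i $ j:]" for i j
    by (rule poly_eqI)
      (simp add: map_sum map_mult mpoly_line_var mpoly_line_const coeff_sum matrix_scale_def coeff_pCons
        mult.commute split: nat.split)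
  then show ?thesis unfolding det_polynomial_def map_det by (simp add: pencil_def)
qed

lemma matrix_basis_of_coords:
  assumes "matrix_basis_of Ms M" "A \<in> M"
  obtains a where "A = (\<Sum>k\<in>UNIV. matrix_scale (a k) (Ms k))"
proof -
  have inj: "inj Ms" and "A \<in> matv.span (range Ms)"
    using assms by (auto simp: matrix_basis_of_def)
  then obtain u where "A = (\<Sum>v\<in>range Ms. matrix_scale (u v) v)"
    by (auto simp: matv.span_finite)
  then have "A = (\<Sum>k\<in>UNIV. matrix_scale (u (Ms k)) (Ms k))"
    using sum.reindex[OF inj, of "\<lambda>v. matrix_scale (u v) v"] by simp
  then show thesis by (rule that)
qed

theorem corollary6:
  fixes M :: "('a::{field,finite}^'r^'r) set"
    and Ms :: "'d::finite \<Rightarrow> 'a^'r^'r"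
    and A B :: "'a^'r^'r"
  assumes "prime CARD('r)"
    and "matv.subspace M"
    and "matrix_basis_of Ms M"
    and "irreducible (det_polynomial Ms)"
    and "\<not> absolutely_irreducible (det_polynomial Ms)"
    and "A \<in> M" and "B \<in> M"
    and "det A \<noteq> 0" and "det B = 0"
  shows "nilpotent_matrix (matrix_inv A ** B)"
proof -
  obtain a where a: "A = (\<Sum>k\<in>UNIV. matrix_scale (a k) (Ms k))"
    using matrix_basis_of_coords assms(3,6) by metis
  obtain b where b: "B = (\<Sum>k\<in>UNIV. matrix_scale (b k) (Ms k))"
    using matrix_basis_of_coords assms(3,7) by metis
  let ?f = "det (pencil A B)"
  have line: "mpoly_line b a (det_polynomial Ms) = ?f"
    unfolding mpoly_line_det_polynomial a b ..
  \<comment> \<open>The coefficient at the degree bound is \<open>det A\<close>, hence nonzero; so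
    the primality of the matrix size is that of the degree.\<close>
  have deg: "degree ?f = CARD('r)"
    using degree_det_pencil[of A B] coeff_det_pencil[of A B] assms(8) le_degree[of ?f "CARD('r)"] by simp
  have "order 0 ?f = CARD('r)"
    using order_mpoly_line_eq_degree[OF assms(4,5), of b a] assms(1,9)
    unfolding line deg poly_det_pencil_0 by simp
  moreover have "?f \<noteq> 0" using coeff_det_pencil[of A B] assms(8) by auto
  \<comment> \<open>Order and degree coincide, so one monomial survives: the order kills the lower
    coefficients, the degree the higher ones.\<close>
  ultimately have "monom 1 CARD('r) dvd ?f" by (simp add: monom_1_dvd_iff)
  then have "coeff ?f i = 0" if "i < CARD('r)" for i using that by (simp add: monom_1_dvd_iff')
  moreover have "coeff ?f i = 0" if "i > CARD('r)" for i using that deg by (intro coeff_eq_0) simp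
  ultimately have "?f = monom (det A) CARD('r)"
    using coeff_det_pencil[of A B] by (intro poly_eqI) (auto simp: neq_iff)
  then show ?thesis using nilpotent_matrix_pencil assms(8) by blast
qed

end
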